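(* Let $\sigma$ be one of the admissible, complete, preferred, semi-stable, or stable semantics, i.e. $\sigma \in \{\mathrm{adm},\mathrm{com},\mathrm{prf},\mathrm{sem},\mathrm{stb}\}$. Then each of the parameterized problems $\sigma$-Small, $\sigma$-Repair, $\sigma$-Adjust, and $\sigma$-Center is $\mathrm{W}[1]$-hard.
   Context: Argumentation frameworks. An argumentation framework (AF) is a pair $F=(X,A)$ with $X$ a finite set (of arguments) and $A\subseteq X\times X$ (the attack relation; self-attacks are allowed). If $(x,y)\in A$, we say $x$ attacks $y$. For $S\subseteq X$ and $x\in X$, $x$ is defended by $S$ if for each $x'\in X$ with $(x',x)\in A$ there is $x''\in S$ with $(x'',x')\in A$. $S$ is conflict-free if there are no $x,x'\in S$ with $(x,x')\in A$. $S^+$ denotes the set of $x\in X$ such that $x\in S$ or some $x'\in S$ satisfies $(x',x)\in A$. Semantics. A semantics $\sigma$ assigns to each AF $F=(X,A)$ a family $\sigma(F)\subseteq 2^X$ of extensions. For conflict-free $S\subseteq X$ (only conflict-free sets can be extensions): - $S\in \mathrm{adm}(F)$ (admissible) iff each $s\in S$ is defended by $S$; - $S\in\mathrm{com}(F)$ (complete) iff $S\in\mathrm{adm}(F)$ and every argument defended by $S$ is in $S$; - $S\in\mathrm{prf}(F)$ (preferred) iff $S\in\mathrm{adm}(F)$ and there is no $T\in\mathrm{adm}(F)$ with $S\subsetneq T$; - $S\in\mathrm{sem}(F)$ (semi-stable) iff $S\in\mathrm{adm}(F)$ and there is no $T\in\mathrm{adm}(F)$ with $S^+\subsetneq T^+$;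 - $S\in\mathrm{stb}(F)$ (stable) iff $S^+=X$. For sets of arguments $E,E'$, $E\bigtriangleup E'$ is the symmetric difference and $\mathrm{dist}(E,E')=|E\bigtriangleup E'|$. Problems (for a semantics $\sigma$): - $\sigma$-Small. Instance: an AF $F=(X,A)$ and a nonnegative integer $k$. Parameter: $k$. Question: is there a nonempty $E\in\sigma(F)$ with $|E|\le k$? - $\sigma$-Repair. Instance: an AF $F=(X,A)$, a set $S\subseteq X$, a nonnegative integer $k$. Parameter: $k$. Question: is there a nonempty $E\in\sigma(F)$ with $\mathrm{dist}(E,S)\le k$? - $\sigma$-Adjust. Instance: an AF $F=(X,A)$, an extension $E_0\in\sigma(F)$, an argument $t\in X$, a nonnegative integer $k$. Parameter: $k$. Question: is there $E\in\sigma(F)$ with $\mathrm{dist}(E,E_0)\le k$ and $t\in E_0\bigtriangleup E$? - $\sigma$-Center. Instance: an AF $F=(X,A)$ and two extensions $E_1,E_2\in\sigma(F)$. Parameter: $\mathrm{dist}(E_1,E_2)$. Question: is there $E\in\sigma(F)$ with $\mathrm{dist}(E,E_i)<\mathrm{dist}(E_1,E_2)$ for every $i\in\{1,2\}$? Parameterized complexity. An fpt-reduction between parameterized problems is a many-one reduction computable in time $f(k)\cdot n^{O(1)}$ ($f$ computable, $n$ the instance size, $k$ the parameter) such that the parameter of the target instance is bounded by a computable function of the parameter of the source instance. A parameterized problem is $\mathrm{W}[1]$-hard if every problem in $\mathrm{W}[1]$ has an fpt-reduction to it; equivalently, if there is an fpt-reduction to it from the $\mathrm{W}[1]$-complete problem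 Multicolored Clique (instance: a natural number $k$ and a $k$-partite graph $G$ with given partition $\{V_1,\dots,V_k\}$; parameter: $k$; question: does $G$ contain a clique of size $k$?). *)

theory Defs
  imports Main
begin

section \<open>Argumentation frameworks\<close>

type_synonym 'a af = "'a set \<times> ('a \<times> 'a) set"

definition is_af :: "'a af \<Rightarrow> bool" where
  "is_af = (\<lambda>(X, A). finite X \<and> A \<subseteq> X \<times> X)"

definition defended :: "'a af \<Rightarrow> 'a set \<Rightarrow> 'a \<Rightarrow> bool" where
  "defended = (\<lambda>(X, A) S x. \<forall>x'\<in>X. (x', x) \<in> A \<longrightarrow> (\<exists>x''\<in>S. (x'', x') \<in> A))"

definition conflict_free :: "'a af \<Rightarrow> 'a set \<Rightarrow> bool" where
  "conflict_free = (\<lambda>(X, A) S. S \<subseteq> X \<and> \<not> (\<exists>x\<in>S. \<exists>x'\<in>S. (x, x') \<in> A))"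

text \<open>The set written \<open>S\<^sup>+\<close> in the literature.\<close>

definition rng :: "'a af \<Rightarrow> 'a set \<Rightarrow> 'a set" where
  "rng = (\<lambda>(X, A) S. {x \<in> X. x \<in> S \<or> (\<exists>x'\<in>S. (x', x) \<in> A)})"

type_synonym 'a semantics = "'a af \<Rightarrow> 'a set set"

definition adm :: "'a semantics" where
  "adm F = {S. conflict_free F S \<and> (\<forall>s\<in>S. defended F S s)}"

definition com :: "'a semantics" where
  "com F = {S \<in> adm F. \<forall>x\<in>fst F. defended F S x \<longrightarrow> x \<in> S}"

definition pref :: "'a semantics" where
  "pref F = {S \<in> adm F. \<not> (\<exists>T\<in>adm F. S \<subset> T)}"

definition sem :: "'a semantics" where
  "sem F = {S \<in> adm F. \<not> (\<exists>T\<in>adm F. rng F S \<subset> rng F T)}"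

definition stb :: "'a semantics" where
  "stb F = {S. conflict_free F S \<and> rng F S = fst F}"

definition distance :: "'a set \<Rightarrow> 'a set \<Rightarrow> nat" where
  "distance E E' = card (sym_diff E E')"

definition small :: "'a semantics \<Rightarrow> 'a af \<Rightarrow> nat \<Rightarrow> bool" where
  "small \<sigma> F k \<longleftrightarrow> (\<exists>E\<in>\<sigma> F. E \<noteq> {} \<and> card E \<le> k)"

definition repair :: "'a semantics \<Rightarrow> 'a af \<Rightarrow> 'a set \<Rightarrow> nat \<Rightarrow> bool" where
  "repair \<sigma> F S k \<longleftrightarrow> (\<exists>E\<in>\<sigma> F. E \<noteq> {} \<and> distance E S \<le> k)"

definition adjust :: "'a semantics \<Rightarrow> 'a af \<Rightarrow> 'a set \<Rightarrow> 'a \<Rightarrow> nat \<Rightarrow> bool" where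
  "adjust \<sigma> F E\<^sub>0 t k \<longleftrightarrow> (\<exists>E\<in>\<sigma> F. distance E E\<^sub>0 \<le> k \<and> t \<in> sym_diff E\<^sub>0 E)"

definition center :: "'a semantics \<Rightarrow> 'a af \<Rightarrow> 'a set \<Rightarrow> 'a set \<Rightarrow> bool" where
  "center \<sigma> F E\<^sub>1 E\<^sub>2 \<longleftrightarrow>
    (\<exists>E\<in>\<sigma> F. distance E E\<^sub>1 < distance E\<^sub>1 E\<^sub>2 \<and> distance E E\<^sub>2 < distance E\<^sub>1 E\<^sub>2)"


section \<open>Multicolored cliques\<close>

text \<open>A simple graph with vertex set \<open>\<Union>(set Vs)\<close>, given by its set of edges (two-element vertex
  sets). Classes of the partition may be empty.\<close>

definition k_partite :: "nat \<Rightarrow> 'a set list \<Rightarrow> 'a set set \<Rightarrow> bool" where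
  "k_partite k Vs Es \<longleftrightarrow>
     length Vs = k \<and> (\<forall>V\<in>set Vs. finite V) \<and>
     (\<forall>i<k. \<forall>j<k. i \<noteq> j \<longrightarrow> Vs ! i \<inter> Vs ! j = {}) \<and>
     (\<forall>e\<in>Es. \<exists>i<k. \<exists>j<k. i \<noteq> j \<and> (\<exists>u\<in>Vs ! i. \<exists>v\<in>Vs ! j. e = {u, v}))"

definition has_clique :: "nat \<Rightarrow> 'a set list \<Rightarrow> 'a set set \<Rightarrow> bool" where
  "has_clique k Vs Es \<longleftrightarrow>
     (\<exists>C \<subseteq> \<Union>(set Vs). card C = k \<and> (\<forall>u\<in>C. \<forall>v\<in>C. u \<noteq> v \<longrightarrow> {u, v} \<in> Es))"


section \<open>Data and computation\<close>

text \<open>Problem instances are binary trees (S-expressions), and computations are performed by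
  while programs on such trees, in the style of Jones' WHILE language. A program is written
  without variables: it maps one tree to another, and a store of several variables is a nested
  pair. Every construct is charged the size of the tree it is applied to (basic operations
  also the size of their result), in addition to the cost of its parts. Hence the size of every
  tree that occurs is bounded by the input size plus the running time, and running times agree
  with those of Turing machines up to a polynomial.\<close>

datatype tree = Leaf | Node (left: tree) (right: tree)
  where
    "left Leaf = Leaf"
  | "right Leaf = Leaf"

primrec tsize :: "tree \<Rightarrow> nat" where
  "tsize Leaf = 1"
| "tsize (Node l r) = tsize l + tsize r + 1"

datatype prog =
    SKIP
  | NIL
  | HD
  | TL
  | EQ
  | CONS prog prog
  | SEQ prog prog
  | IF prog prog prog
  | WHILE prog prog

text \<open>\<open>exec p x y t\<close>: program \<open>p\<close>, started on \<open>x\<close>, halts with result \<open>y\<close> at cost \<open>t\<close>. \<open>Leaf\<close> is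
  the truth value false and every other tree is true.\<close>

inductive exec :: "prog \<Rightarrow> tree \<Rightarrow> tree \<Rightarrow> nat \<Rightarrow> bool" where
  skip: "exec SKIP x x (tsize x + tsize x)"
| nil: "exec NIL x Leaf (tsize x + tsize Leaf)"
| hd: "exec HD x (left x) (tsize x + tsize (left x))"
| tl: "exec TL x (right x) (tsize x + tsize (right x))"
| eq: "b = (if left x = right x then Node Leaf Leaf else Leaf) \<Longrightarrow>
    exec EQ x b (tsize x + tsize b)"
| cons: "exec p x y s \<Longrightarrow> exec q x z t \<Longrightarrow> exec (CONS p q) x (Node y z) (s + t + tsize x)"
| seq: "exec p x y s \<Longrightarrow> exec q y z t \<Longrightarrow> exec (SEQ p q) x z (s + t + tsize x)"
| if_true: "exec b x v s \<Longrightarrow> v \<noteq> Leaf \<Longrightarrow> exec p x y t \<Longrightarrow> exec (IF b p q) x y (s + t + tsize x)"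
| if_false: "exec b x Leaf s \<Longrightarrow> exec q x y t \<Longrightarrow> exec (IF b p q) x y (s + t + tsize x)"
| while_false: "exec b x Leaf s \<Longrightarrow> exec (WHILE b p) x x (s + tsize x)"
| while_true: "exec b x v s \<Longrightarrow> v \<noteq> Leaf \<Longrightarrow> exec p x y t \<Longrightarrow> exec (WHILE b p) y z u \<Longrightarrow>
    exec (WHILE b p) x z (s + t + u + tsize x)"

text \<open>Every tree is the code of exactly one list of trees, namely of the left subtrees along
  its right spine. Numbers are coded in unary, as the length of such a list.\<close>

primrec list_of :: "tree \<Rightarrow> tree list" where
  "list_of Leaf = []"
| "list_of (Node l r) = l # list_of r"

definition nat_of :: "tree \<Rightarrow> nat" where
  "nat_of d = length (list_of d)"

definition set_of :: "tree \<Rightarrow> tree set" where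
  "set_of d = set (list_of d)"

definition rel_of :: "tree \<Rightarrow> (tree \<times> tree) set" where
  "rel_of d = {(a, b). Node a b \<in> set_of d}"

definition af_of :: "tree \<Rightarrow> tree af" where
  "af_of d = (set_of (left d), rel_of (right d))"

definition edges_of :: "tree \<Rightarrow> tree set set" where
  "edges_of d = {{u, v} | u v. (u, v) \<in> rel_of d}"

primrec unary :: "nat \<Rightarrow> tree" where
  "unary 0 = Leaf"
| "unary (Suc n) = Node Leaf (unary n)"

definition computable :: "(nat \<Rightarrow> nat) \<Rightarrow> bool" where
  "computable f \<longleftrightarrow> (\<exists>p. \<forall>k. \<exists>t. exec p (unary k) (unary (f k)) t)"


section \<open>Parameterized problems and W[1]-hardness\<close>

text \<open>The question \<open>yes\<close> is only asked about trees in \<open>instances\<close>. A reduction has to map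
  instances to instances and may behave arbitrarily on other trees.\<close>

record problem =
  instances :: "tree set"
  parameter :: "tree \<Rightarrow> nat"
  yes :: "tree \<Rightarrow> bool"

definition fpt_reducible :: "problem \<Rightarrow> problem \<Rightarrow> bool" (infix "\<le>\<^sub>f\<^sub>p\<^sub>t" 50) where
  "P \<le>\<^sub>f\<^sub>p\<^sub>t Q \<longleftrightarrow>
    (\<exists>p r f g c. computable f \<and> computable g \<and>
      (\<forall>x\<in>instances P.
        (\<exists>t. exec p x (r x) t \<and> t \<le> f (parameter P x) * tsize x ^ c) \<and>
        r x \<in> instances Q \<and>
        (yes Q (r x) \<longleftrightarrow> yes P x) \<and>
        parameter Q (r x) \<le> g (parameter P x)))"

definition multicolored_clique :: problem where
  "multicolored_clique =
    \<lparr> instances = {d. \<exists>k Vs Es. d = Node k (Node Vs Es) \<and>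
        k_partite (nat_of k) (map set_of (list_of Vs)) (edges_of Es)},
      parameter = (\<lambda>d. nat_of (left d)),
      yes = (\<lambda>d. \<exists>k Vs Es. d = Node k (Node Vs Es) \<and>
        has_clique (nat_of k) (map set_of (list_of Vs)) (edges_of Es)) \<rparr>"

text \<open>W[1] as the class of problems reducible to its com problem Multicolored Clique.\<close>

definition W1 :: "problem set" where
  "W1 = {P. P \<le>\<^sub>f\<^sub>p\<^sub>t multicolored_clique}"

definition W1_hard :: "problem \<Rightarrow> bool" where
  "W1_hard Q \<longleftrightarrow> (\<forall>P\<in>W1. P \<le>\<^sub>f\<^sub>p\<^sub>t Q)"

definition small_problem :: "tree semantics \<Rightarrow> problem" where
  "small_problem \<sigma> =
    \<lparr> instances = {d. \<exists>F k. d = Node F k \<and> is_af (af_of F)},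
      parameter = (\<lambda>d. nat_of (right d)),
      yes = (\<lambda>d. \<exists>F k. d = Node F k \<and> small \<sigma> (af_of F) (nat_of k)) \<rparr>"

definition repair_problem :: "tree semantics \<Rightarrow> problem" where
  "repair_problem \<sigma> =
    \<lparr> instances = {d. \<exists>F S k. d = Node F (Node S k) \<and> is_af (af_of F) \<and>
        set_of S \<subseteq> fst (af_of F)},
      parameter = (\<lambda>d. nat_of (right (right d))),
      yes = (\<lambda>d. \<exists>F S k. d = Node F (Node S k) \<and>
        repair \<sigma> (af_of F) (set_of S) (nat_of k)) \<rparr>"

definition adjust_problem :: "tree semantics \<Rightarrow> problem" where
  "adjust_problem \<sigma> =
    \<lparr> instances = {d. \<exists>F E\<^sub>0 t k. d = Node F (Node E\<^sub>0 (Node t k)) \<and> is_af (af_of F) \<and>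
        set_of E\<^sub>0 \<in> \<sigma> (af_of F) \<and> t \<in> fst (af_of F)},
      parameter = (\<lambda>d. nat_of (right (right (right d)))),
      yes = (\<lambda>d. \<exists>F E\<^sub>0 t k. d = Node F (Node E\<^sub>0 (Node t k)) \<and>
        adjust \<sigma> (af_of F) (set_of E\<^sub>0) t (nat_of k)) \<rparr>"

definition center_problem :: "tree semantics \<Rightarrow> problem" where
  "center_problem \<sigma> =
    \<lparr> instances = {d. \<exists>F E\<^sub>1 E\<^sub>2. d = Node F (Node E\<^sub>1 E\<^sub>2) \<and> is_af (af_of F) \<and>
        set_of E\<^sub>1 \<in> \<sigma> (af_of F) \<and> set_of E\<^sub>2 \<in> \<sigma> (af_of F)},
      parameter = (\<lambda>d. distance (set_of (left (right d))) (set_of (right (right d)))),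
      yes = (\<lambda>d. \<exists>F E\<^sub>1 E\<^sub>2. d = Node F (Node E\<^sub>1 E\<^sub>2) \<and>
        center \<sigma> (af_of F) (set_of E\<^sub>1) (set_of E\<^sub>2)) \<rparr>"


section \<open>Hardness via Multicolored Clique\<close>

text \<open>Reductions compose, so \<open>W1_hard Q\<close> amounts to a single reduction from Multicolored
  Clique.\<close>

lemma tsize_pos: "tsize x \<ge> 1" by (cases x) auto

lemma exec_size: "exec p x y t \<Longrightarrow> tsize y \<le> t"
proof (induction rule: exec.induct)
  case (cons p x y s q z t)
  then show ?case using tsize_pos[of x] by simp
qed auto

definition halts :: "prog \<Rightarrow> tree \<Rightarrow> tree \<Rightarrow> bool" where
  "halts p x y \<longleftrightarrow> (\<exists>t. exec p x y t)"

lemma halts_skip: "halts SKIP x x" and halts_nil: "halts NIL x Leaf" and halts_hd: "halts HD x (left x)"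
  and halts_tl: "halts TL x (right x)"
  unfolding halts_def by (blast intro: exec.intros)+
lemma halts_cons: "halts p x y \<Longrightarrow> halts q x z \<Longrightarrow> halts (CONS p q) x (Node y z)"
  and halts_seq: "halts p x y \<Longrightarrow> halts q y z \<Longrightarrow> halts (SEQ p q) x z"
  and halts_wf: "halts b x Leaf \<Longrightarrow> halts (WHILE b p) x x"
  and halts_wt: "halts b x v \<Longrightarrow> v \<noteq> Leaf \<Longrightarrow> halts p x y \<Longrightarrow> halts (WHILE b p) y z \<Longrightarrow> halts (WHILE b p) x z"
  unfolding halts_def by (blast intro: exec.intros)+

lemma halts_hd': "halts HD (Node a b) a" and halts_tl': "halts TL (Node a b) b"
  using halts_hd[of "Node a b"] halts_tl[of "Node a b"] by auto

text \<open>\<open>LOOP q\<close> works on \<open>Node (unary n) s\<close> and replaces \<open>s\<close> by the result of applying \<open>q\<close> to it \<open>n\<close> times.\<close>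

definition LOOP :: "prog \<Rightarrow> prog" where
  "LOOP q = WHILE HD (CONS (SEQ HD TL) (SEQ TL q))"

lemma halts_loop:
  assumes "\<And>i. i < n \<Longrightarrow> halts q (s i) (s (Suc i))"
  shows "halts (LOOP q) (Node (unary n) (s 0)) (Node Leaf (s n))"
proof -
  have "halts (LOOP q) (Node (unary (n - i)) (s i)) (Node Leaf (s n))" if "i \<le> n" for i
    using that
  proof (induction "n - i" arbitrary: i)
    case 0
    then have "i = n" by simp
    then show ?case using halts_wf[of HD "Node Leaf (s n)"] halts_hd[of "Node Leaf (s n)"]
      by (simp add: LOOP_def)
  next
    case (Suc m)
    then have i: "i < n" and e: "n - i = Suc (n - Suc i)" by auto
    have "halts (LOOP q) (Node (unary (n - Suc i)) (s (Suc i))) (Node Leaf (s n))"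
      using Suc by auto
    moreover have "halts (CONS (SEQ HD TL) (SEQ TL q)) (Node (unary (n - i)) (s i))
       (Node (unary (n - Suc i)) (s (Suc i)))"
      using assms[OF i] e by (auto intro!: halts_cons halts_seq[OF halts_hd'] halts_seq[OF halts_tl'] simp: halts_tl')
    ultimately show ?case unfolding LOOP_def
      using halts_wt[OF halts_hd'] e by (metis tree.distinct(1) unary.simps(2))
  qed
  from this[of 0] show ?thesis by simp
qed

lemma computable_alt: "computable f \<longleftrightarrow> (\<exists>p. \<forall>k. halts p (unary k) (unary (f k)))"
  by (simp add: computable_def halts_def)

lemma computable_id: "computable (\<lambda>k. k)"
  unfolding computable_alt using halts_skip by blast

lemma computable_comp: "computable f \<Longrightarrow> computable g \<Longrightarrow> computable (\<lambda>k. f (g k))"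
  unfolding computable_alt using halts_seq by blast

lemma halts_inc: "halts (CONS NIL SKIP) (unary n) (unary (Suc n))"
  by (auto intro!: halts_cons halts_nil halts_skip)

lemma computable_const: "computable (\<lambda>k. c)"
proof (induction c)
  case 0 then show ?case unfolding computable_alt using halts_nil by auto
next
  case (Suc c) then show ?case unfolding computable_alt using halts_inc halts_seq by blast
qed

definition ADD :: prog where
  "ADD = SEQ (LOOP (CONS NIL SKIP)) TL"

lemma halts_add: "halts ADD (Node (unary a) (unary b)) (unary (a + b))"
  using halts_loop[of a "CONS NIL SKIP" "\<lambda>i. unary (i + b)"] halts_inc
  unfolding ADD_def by (auto intro!: halts_seq[OF _ halts_tl'])

lemma computable_add:
  assumes "computable f" "computable g" shows "computable (\<lambda>k. f k + g k)"
proof -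
  from assms obtain p q where "\<forall>k. halts p (unary k) (unary (f k))" "\<forall>k. halts q (unary k) (unary (g k))"
    unfolding computable_alt by blast
  then have "halts (SEQ (CONS p q) ADD) (unary k) (unary (f k + g k))" for k
    by (blast intro: halts_seq halts_cons halts_add)
  then show ?thesis unfolding computable_alt by blast
qed

definition MUL :: prog where
  "MUL = SEQ (SEQ (CONS HD (CONS TL NIL)) (LOOP (CONS HD ADD))) (SEQ TL TL)"

lemma halts_mul: "halts MUL (Node (unary a) (unary b)) (unary (a * b))"
proof -
  have "halts (LOOP (CONS HD ADD)) (Node (unary a) (Node (unary b) (unary (0 * b))))
     (Node Leaf (Node (unary b) (unary (a * b))))"
    by (rule halts_loop) (use halts_add[of b] in \<open>auto intro!: halts_cons halts_hd'\<close>)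
  then show ?thesis unfolding MUL_def
    by (auto intro!: halts_seq[OF halts_seq] halts_seq[OF halts_tl'] halts_cons halts_hd' halts_nil halts_tl')
qed

lemma computable_mul:
  assumes "computable f" "computable g" shows "computable (\<lambda>k. f k * g k)"
proof -
  from assms obtain p q where "\<forall>k. halts p (unary k) (unary (f k))" "\<forall>k. halts q (unary k) (unary (g k))"
    unfolding computable_alt by blast
  then have "halts (SEQ (CONS p q) MUL) (unary k) (unary (f k * g k))" for k
    by (blast intro: halts_seq halts_cons halts_mul)
  then show ?thesis unfolding computable_alt by blast
qed

lemma computable_pow: "computable f \<Longrightarrow> computable (\<lambda>k. f k ^ c)"
  by (induction c) (auto intro: computable_const[of 1, simplified] computable_mul)

lemma computable_sum:
  assumes "computable f" shows "computable (\<lambda>k. \<Sum>j<Suc k. f j)"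
proof -
  from assms obtain p where p: "\<And>k. halts p (unary k) (unary (f k))" unfolding computable_alt by blast
  let ?q = "CONS (SEQ HD (CONS NIL SKIP)) (SEQ (CONS (SEQ HD p) TL) ADD)"
  have "halts (LOOP ?q) (Node (unary n) (Node (unary 0) (unary (\<Sum>j<0. f j))))
     (Node Leaf (Node (unary n) (unary (\<Sum>j<n. f j))))" for n
  proof (rule halts_loop)
    fix i
    have "halts (CONS (SEQ HD p) TL) (Node (unary i) (unary (\<Sum>j<i. f j))) (Node (unary (f i)) (unary (\<Sum>j<i. f j)))"
      by (blast intro: halts_cons halts_seq halts_hd' halts_tl' p)
    from halts_seq[OF this halts_add] have "halts (SEQ (CONS (SEQ HD p) TL) ADD) (Node (unary i) (unary (\<Sum>j<i. f j))) (unary (\<Sum>j<Suc i. f j))"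
      by (simp add: add.commute)
    then show "halts ?q (Node (unary i) (unary (\<Sum>j<i. f j))) (Node (unary (Suc i)) (unary (\<Sum>j<Suc i. f j)))"
      by (blast intro: halts_cons halts_seq halts_hd' halts_inc)
  qed
  from this[of "Suc k" for k]
  have "halts (SEQ (CONS (CONS NIL SKIP) (CONS NIL NIL)) (SEQ (LOOP ?q) (SEQ TL TL))) (unary k) (unary (\<Sum>j<Suc k. f j))" for k
    by (intro halts_seq[OF halts_cons[OF halts_inc halts_cons[OF halts_nil halts_nil]]] halts_seq[OF _ halts_seq[OF halts_tl' halts_tl']]) simp
  then show ?thesis unfolding computable_alt by blast
qed

lemma sum_ub: "j \<le> k \<Longrightarrow> f j \<le> (\<Sum>j<Suc k. f j :: nat)"
  by (rule member_le_sum) auto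

lemma fpt_refl: "P \<le>\<^sub>f\<^sub>p\<^sub>t P"
proof -
  have "\<exists>t. exec SKIP x (id x) t \<and> t \<le> 2 * tsize x ^ 1" for x
    using exec.skip[of x] by (intro exI[of _ "tsize x + tsize x"]) auto
  then show ?thesis unfolding fpt_reducible_def
    by (intro exI[of _ SKIP] exI[of _ id] exI[of _ "\<lambda>k. 2"] exI[of _ "\<lambda>k. k"] exI[of _ 1])
       (auto intro: computable_const computable_id)
qed

lemma fpt_trans: assumes "P \<le>\<^sub>f\<^sub>p\<^sub>t Q" "Q \<le>\<^sub>f\<^sub>p\<^sub>t R" shows "P \<le>\<^sub>f\<^sub>p\<^sub>t R"
proof -
  from assms(1) obtain p r f g c where 1: "computable f" "computable g"
    "\<And>x. x\<in>instances P \<Longrightarrow>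
        (\<exists>t. exec p x (r x) t \<and> t \<le> f (parameter P x) * tsize x ^ c) \<and>
        r x \<in> instances Q \<and> (yes Q (r x) \<longleftrightarrow> yes P x) \<and> parameter Q (r x) \<le> g (parameter P x)"
    unfolding fpt_reducible_def by blast
  from assms(2) obtain p' r' f' g' c' where 2: "computable f'" "computable g'"
    "\<And>x. x\<in>instances Q \<Longrightarrow>
        (\<exists>t. exec p' x (r' x) t \<and> t \<le> f' (parameter Q x) * tsize x ^ c') \<and>
        r' x \<in> instances R \<and> (yes R (r' x) \<longleftrightarrow> yes Q x) \<and> parameter R (r' x) \<le> g' (parameter Q x)"
    unfolding fpt_reducible_def by blast
  define G where "G k = (\<Sum>j<Suc (g k). g' j)" for k
  define M where "M k = (\<Sum>j<Suc (g k). f' j)" for k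
  define F where "F k = f k + M k * f k ^ c' + 1" for k
  define C where "C = c + c * c' + 1"
  have cG: "computable G" unfolding G_def by (rule computable_comp[OF computable_sum[OF 2(2)] 1(2)])
  have cM: "computable M" unfolding M_def by (rule computable_comp[OF computable_sum[OF 2(1)] 1(2)])
  have cF: "computable F" unfolding F_def
    by (intro computable_add computable_mul computable_pow computable_const cM 1(1))
  show ?thesis unfolding fpt_reducible_def
  proof (rule exI[of _ "SEQ p p'"], rule exI[of _ "r' \<circ> r"], rule exI[of _ F], rule exI[of _ G],
      rule exI[of _ C], intro conjI ballI)
    fix x assume x: "x \<in> instances P"
    let ?k = "parameter P x" and ?n = "tsize x"
    note a = 1(3)[OF x]
    then have b: "r x \<in> instances Q" by blast
    note c = 2(3)[OF b]
    from a obtain t where t: "exec p x (r x) t" "t \<le> f ?k * ?n ^ c" by blast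
    from c obtain t' where t': "exec p' (r x) (r' (r x)) t'"
      "t' \<le> f' (parameter Q (r x)) * tsize (r x) ^ c'" by blast
    have n: "?n \<ge> 1" by (rule tsize_pos)
    have kb: "parameter Q (r x) \<le> g ?k" using a by blast
    have s: "tsize (r x) \<le> f ?k * ?n ^ c" using exec_size[OF t(1)] t(2) by linarith
    have "t' \<le> M ?k * (f ?k * ?n ^ c) ^ c'"
      using t'(2) mult_le_mono[OF sum_ub[OF kb, of f'] power_mono[OF s, of c']] by (simp add: M_def)
    also have "\<dots> = M ?k * f ?k ^ c' * ?n ^ (c * c')" by (simp add: power_mult_distrib power_mult)
    also have "\<dots> \<le> M ?k * f ?k ^ c' * ?n ^ C"
      using n by (intro mult_le_mono2 power_increasing) (auto simp: C_def)
    finally have T': "t' \<le> M ?k * f ?k ^ c' * ?n ^ C" .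
    have "f ?k * ?n ^ c \<le> f ?k * ?n ^ C"
      using n by (intro mult_le_mono2 power_increasing) (auto simp: C_def)
    then have T: "t \<le> f ?k * ?n ^ C" using t by linarith
    have "?n ^ 1 \<le> ?n ^ C" using n by (intro power_increasing) (auto simp: C_def)
    then have "t + t' + ?n \<le> F ?k * ?n ^ C" using T T' by (simp add: F_def algebra_simps)
    then show "\<exists>t. exec (SEQ p p') x ((r' \<circ> r) x) t \<and> t \<le> F ?k * ?n ^ C"
      using exec.seq[OF t(1) t'(1)] by auto
    show "(r' \<circ> r) x \<in> instances R" "yes R ((r' \<circ> r) x) = yes P x" using a c by auto
    show "parameter R ((r' \<circ> r) x) \<le> G ?k" unfolding G_def comp_def
      using c sum_ub[OF kb, of g'] by linarith
  qed (use cF cG in auto)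
qed

lemma W1_hard_iff: "W1_hard Q \<longleftrightarrow> multicolored_clique \<le>\<^sub>f\<^sub>p\<^sub>t Q"
  unfolding W1_hard_def W1_def using fpt_refl fpt_trans by blast

end

(* A single framework serves all four problems. Besides the vertices u (tag tV) of the k-partite
   graph it has arguments a_s, b_s, p_s, q_s, w_s (tags tA, tB, tP, tQ, tW), where s ranges over k + 2
   indices, k of them belonging to the parts of the graph, and one further argument z (tag tZ).
   The arguments q_s and w_s attack everything, including themselves. Hence they belong to no
   extension, but every nonempty admissible set E has to attack all of them. Only p_s attacks q_s,
   so E contains every p_s. Only a_s, b_s and the vertices of the part belonging to s attack w_s,
   and z does so for the two additional s. The a's, the b's, and the vertices together with z attack
   each other, and so do distinct nonadjacent vertices; thus E is one of a + p, b + p, or C + z + p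
   for a clique C meeting every part. All these sets are stable, so the five semantics have the
   same nonempty extensions, of size 2k + 4, 2k + 4 and 2k + 3, respectively. The sets a + p and
   b + p have distance 2k + 4 from each other and from the empty set, but distance 2k + 3 from
   C + z + p, which gives all four reductions. *)

theory Submission
  imports Defs
begin

section \<open>Polynomial-time functions\<close>

definition polybounded :: "(nat \<Rightarrow> nat) \<Rightarrow> bool" where
  "polybounded B \<longleftrightarrow> mono B \<and> (\<exists>c. \<forall>n\<ge>1. B n \<le> c * n ^ c)"

text \<open>Raising coefficient and exponent to the common value \<open>a + b\<close> only weakens
  the bound, as \<open>n \<ge> 1\<close>. So one number can play both roles in
  \<open>polybounded\<close>.\<close>

lemma polyboundedI:
  assumes "mono B" "\<And>n. n \<ge> 1 \<Longrightarrow> B n \<le> a * n ^ b"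
  shows "polybounded B"
proof -
  have "B n \<le> (a + b) * n ^ (a + b)" if "n \<ge> 1" for n
    using assms(2)[OF that] mult_le_mono[of a "a + b" "n ^ b" "n ^ (a + b)"]
      power_increasing[of b "a + b" n] that by auto
  then show ?thesis using assms(1) unfolding polybounded_def by blast
qed

lemma polybounded_const: "polybounded (\<lambda>n. c)"
  by (rule polyboundedI[of _ c 0]) (auto simp: mono_def)

lemma polybounded_id: "polybounded (\<lambda>n. n)"
  by (rule polyboundedI[of _ 1 1]) (auto simp: mono_def)

lemma polybounded_add:
  assumes "polybounded A" "polybounded B" shows "polybounded (\<lambda>n. A n + B n)"
proof -
  obtain a b where ab: "\<And>n. n \<ge> 1 \<Longrightarrow> A n \<le> a * n ^ a" "\<And>n. n \<ge> 1 \<Longrightarrow> B n \<le> b * n ^ b"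
    using assms unfolding polybounded_def by blast
  have "A n + B n \<le> (a + b) * n ^ (a + b)" if "n \<ge> 1" for n
  proof -
    have "a * n ^ a \<le> a * n ^ (a + b)" "b * n ^ b \<le> b * n ^ (a + b)"
      using that by (intro mult_le_mono2 power_increasing; simp)+
    then show ?thesis using ab[OF that] by (simp only: add_mult_distrib)
  qed
  then show ?thesis
    using assms by (intro polyboundedI) (auto simp: polybounded_def mono_def add_mono)
qed

lemma polybounded_mult:
  assumes "polybounded A" "polybounded B" shows "polybounded (\<lambda>n. A n * B n)"
proof -
  obtain a b where ab: "\<And>n. n \<ge> 1 \<Longrightarrow> A n \<le> a * n ^ a" "\<And>n. n \<ge> 1 \<Longrightarrow> B n \<le> b * n ^ b"
    using assms unfolding polybounded_def by blast
  have "A n * B n \<le> (a * b) * n ^ (a + b)" if "n \<ge> 1" for n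
    using mult_le_mono[OF ab[OF that]] by (simp add: power_add mult_ac)
  then show ?thesis
    using assms by (intro polyboundedI) (auto simp: polybounded_def mono_def mult_le_mono)
qed

lemma polybounded_comp:
  assumes "polybounded A" "polybounded B" shows "polybounded (\<lambda>n. A (B n))"
proof -
  obtain a b where ab: "\<And>n. n \<ge> 1 \<Longrightarrow> A n \<le> a * n ^ a" "\<And>n. n \<ge> 1 \<Longrightarrow> B n \<le> b * n ^ b"
    and m: "mono A" "mono B"
    using assms unfolding polybounded_def by blast
  have "A (B n) \<le> (a * (b + 1) ^ a) * n ^ (b * a)" if n: "n \<ge> 1" for n
  proof -
    \<comment> \<open>\<open>B n\<close> may be 0, where nothing is known about \<open>A\<close>
      beyond monotonicity; the successor is in the range of its bound.\<close>
    have "B n + 1 \<le> b * n ^ b + n ^ b" using ab(2)[OF n] n by (intro add_mono) auto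
    also have "\<dots> = (b + 1) * n ^ b" by (simp add: add_mult_distrib)
    finally have *: "B n + 1 \<le> (b + 1) * n ^ b" .
    have "A (B n) \<le> A (B n + 1)" using m(1) by (simp add: mono_def)
    also have "\<dots> \<le> a * (B n + 1) ^ a" by (rule ab) simp
    also have "\<dots> \<le> a * ((b + 1) * n ^ b) ^ a" by (intro mult_le_mono2 power_mono *) simp
    finally show ?thesis by (simp only: power_mult_distrib power_mult mult.assoc)
  qed
  then show ?thesis using m by (intro polyboundedI) (auto simp: mono_def)
qed

lemmas polybounded_intros =
  polybounded_const polybounded_id polybounded_add polybounded_mult

text \<open>This is why monotonicity belongs to \<open>polybounded\<close>: costs are bounded in the
  size of an intermediate tree, of which only an upper bound is known.\<close>

lemma polyboundedD: "polybounded B \<Longrightarrow> m \<le> n \<Longrightarrow> B m \<le> B n"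
  by (simp add: polybounded_def mono_def)

section \<open>Functions on trees computable in polynomial time\<close>

definition polytime :: "(tree \<Rightarrow> tree) \<Rightarrow> bool" where
  "polytime f \<longleftrightarrow> (\<exists>p B. polybounded B \<and> (\<forall>x. \<exists>t. exec p x (f x) t \<and> t \<le> B (tsize x)))"

text \<open>The result is never larger than the cost of producing it, so the same \<open>B\<close>
  bounds the output size. Composition and loops rely on this.\<close>

lemma polytimeE:
  assumes "polytime f"
  obtains p B where "polybounded B" "\<And>x. \<exists>t. exec p x (f x) t \<and> t \<le> B (tsize x)"
    "\<And>x. tsize (f x) \<le> B (tsize x)"
proof -
  obtain p B where *: "polybounded B" "\<And>x. \<exists>t. exec p x (f x) t \<and> t \<le> B (tsize x)"
    using assms unfolding polytime_def by blast
  moreover have "tsize (f x) \<le> B (tsize x)" for x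
    using *(2)[of x] exec_size le_trans by blast
  ultimately show thesis using that by blast
qed

lemma polytimeI:
  assumes "polybounded B" "\<And>x. \<exists>t. exec p x (f x) t \<and> t \<le> B (tsize x)"
  shows "polytime f"
  using assms unfolding polytime_def by blast

lemma tsize_sub: "tsize (left x) \<le> tsize x" "tsize (right x) \<le> tsize x"
  by (cases x; simp)+

lemma polytime_id: "polytime (\<lambda>x. x)"
proof (rule polytimeI[of "\<lambda>n. n + n" SKIP])
  show "\<exists>t. exec SKIP x x t \<and> t \<le> tsize x + tsize x" for x
    using exec.skip[of x] by blast
qed (intro polybounded_intros)

lemma polytime_comp:
  assumes "polytime f" "polytime g" shows "polytime (\<lambda>x. f (g x))"
proof -
  from assms(1) obtain p B where p: "polybounded B" "\<And>x. \<exists>t. exec p x (f x) t \<and> t \<le> B (tsize x)"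
    by (elim polytimeE) blast
  from assms(2) obtain q C where q: "polybounded C" "\<And>x. \<exists>t. exec q x (g x) t \<and> t \<le> C (tsize x)"
    "\<And>x. tsize (g x) \<le> C (tsize x)"
    by (elim polytimeE) blast
  show ?thesis
  proof (rule polytimeI[of "\<lambda>n. C n + B (C n) + n" "SEQ q p"])
    show "polybounded (\<lambda>n. C n + B (C n) + n)"
      using p(1) q(1) by (intro polybounded_intros polybounded_comp[of B C])
    fix x
    obtain t where t: "exec q x (g x) t" "t \<le> C (tsize x)" using q by blast
    obtain u where u: "exec p (g x) (f (g x)) u" "u \<le> B (tsize (g x))" using p by blast
    have "u \<le> B (C (tsize x))" using u(2) polyboundedD[OF p(1) q(3)[of x]] by linarith
    then show "\<exists>t. exec (SEQ q p) x (f (g x)) t \<and> t \<le> C (tsize x) + B (C (tsize x)) + tsize x"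
      using exec.seq[OF t(1) u(1)] t(2) by (intro exI[of _ "t + u + tsize x"]) auto
  qed
qed

lemma polytime_left_selector: "polytime left"
proof (rule polytimeI[of "\<lambda>n. n + n" HD])
  show "\<exists>t. exec HD x (left x) t \<and> t \<le> tsize x + tsize x" for x
    using exec.hd[of x] tsize_sub(1)[of x] by (meson add_left_mono)
qed (intro polybounded_intros)

lemma polytime_right_selector: "polytime right"
proof (rule polytimeI[of "\<lambda>n. n + n" TL])
  show "\<exists>t. exec TL x (right x) t \<and> t \<le> tsize x + tsize x" for x
    using exec.tl[of x] tsize_sub(2)[of x] by (meson add_left_mono)
qed (intro polybounded_intros)

lemma polytime_left: "polytime f \<Longrightarrow> polytime (\<lambda>x. left (f x))"
  and polytime_right: "polytime f \<Longrightarrow> polytime (\<lambda>x. right (f x))"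
  using polytime_comp polytime_left_selector polytime_right_selector by blast+

lemma polytime_Leaf: "polytime (\<lambda>x. Leaf)"
proof (rule polytimeI[of "\<lambda>n. n + 1" NIL])
  show "\<exists>t. exec NIL x Leaf t \<and> t \<le> tsize x + 1" for x
    using exec.nil[of x] by auto
qed (intro polybounded_intros)

lemma polytime_Node:
  assumes "polytime f" "polytime g" shows "polytime (\<lambda>x. Node (f x) (g x))"
proof -
  from assms(1) obtain p B where p: "polybounded B" "\<And>x. \<exists>t. exec p x (f x) t \<and> t \<le> B (tsize x)"
    by (elim polytimeE) blast
  from assms(2) obtain q C where q: "polybounded C" "\<And>x. \<exists>t. exec q x (g x) t \<and> t \<le> C (tsize x)"
    by (elim polytimeE) blast
  show ?thesis
  proof (rule polytimeI[of "\<lambda>n. B n + C n + n" "CONS p q"])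
    show "polybounded (\<lambda>n. B n + C n + n)" using p(1) q(1) by (intro polybounded_intros)
    fix x
    obtain t where t: "exec p x (f x) t" "t \<le> B (tsize x)" using p by blast
    obtain u where u: "exec q x (g x) u" "u \<le> C (tsize x)" using q by blast
    show "\<exists>t. exec (CONS p q) x (Node (f x) (g x)) t \<and> t \<le> B (tsize x) + C (tsize x) + tsize x"
      using exec.cons[OF t(1) u(1)] t u by (intro exI[of _ "t + u + tsize x"]) auto
  qed
qed

lemma polytime_const: "polytime (\<lambda>x. c)"
  by (induction c) (auto intro: polytime_Leaf polytime_Node)

lemma polytime_if_Leaf:
  assumes "polytime b" "polytime f" "polytime g"
  shows "polytime (\<lambda>x. if b x = Leaf then g x else f x)"
proof -
  from assms(1) obtain r D where r: "polybounded D" "\<And>x. \<exists>t. exec r x (b x) t \<and> t \<le> D (tsize x)"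
    by (elim polytimeE) blast
  from assms(2) obtain p B where p: "polybounded B" "\<And>x. \<exists>t. exec p x (f x) t \<and> t \<le> B (tsize x)"
    by (elim polytimeE) blast
  from assms(3) obtain q C where q: "polybounded C" "\<And>x. \<exists>t. exec q x (g x) t \<and> t \<le> C (tsize x)"
    by (elim polytimeE) blast
  show ?thesis
  proof (rule polytimeI[of "\<lambda>n. D n + (B n + C n) + n" "IF r p q"])
    show "polybounded (\<lambda>n. D n + (B n + C n) + n)" using p(1) q(1) r(1) by (intro polybounded_intros)
    fix x
    obtain s where s: "exec r x (b x) s" "s \<le> D (tsize x)" using r by blast
    obtain t where t: "exec p x (f x) t" "t \<le> B (tsize x)" using p by blast
    obtain u where u: "exec q x (g x) u" "u \<le> C (tsize x)" using q by blast
    show "\<exists>t. exec (IF r p q) x (if b x = Leaf then g x else f x) t \<and>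
        t \<le> D (tsize x) + (B (tsize x) + C (tsize x)) + tsize x"
    proof (cases "b x = Leaf")
      case True
      then show ?thesis using exec.if_false[of r x s q "g x" u p] s t u
        by (intro exI[of _ "s + u + tsize x"]) auto
    next
      case False
      then show ?thesis using exec.if_true[of r x "b x" s p "f x" t q] s t u
        by (intro exI[of _ "s + t + tsize x"]) auto
    qed
  qed
qed

text \<open>The two truth values are those returned by \<open>EQ\<close>, so a predicate can serve
  directly as the condition of an \<open>IF\<close>.\<close>

definition polypred :: "(tree \<Rightarrow> bool) \<Rightarrow> bool" where
  "polypred P \<longleftrightarrow> polytime (\<lambda>x. if P x then Node Leaf Leaf else Leaf)"

lemma polytime_if:
  assumes "polypred P" "polytime f" "polytime g"
  shows "polytime (\<lambda>x. if P x then f x else g x)"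
proof -
  have "(\<lambda>x. if P x then f x else g x) =
      (\<lambda>x. if (if P x then Node Leaf Leaf else Leaf) = Leaf then g x else f x)" by auto
  then show ?thesis using polytime_if_Leaf[OF assms[unfolded polypred_def]] by simp
qed

lemma polypred_eq:
  assumes "polytime f" "polytime g" shows "polypred (\<lambda>x. f x = g x)"
proof -
  have "polytime (\<lambda>x. if left x = right x then Node Leaf Leaf else Leaf)"
  proof (rule polytimeI[of "\<lambda>n. n + 3" EQ])
    fix x
    let ?b = "if left x = right x then Node Leaf Leaf else Leaf"
    show "\<exists>t. exec EQ x ?b t \<and> t \<le> tsize x + 3"
      using exec.eq[OF refl, of x] by (intro exI[of _ "tsize x + tsize ?b"]) auto
  qed (intro polybounded_intros)
  from polytime_comp[OF this polytime_Node[OF assms]] show ?thesis by (simp add: polypred_def)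
qed

lemma polypred_const: "polypred (\<lambda>x. b)"
  unfolding polypred_def by (rule polytime_const)

lemma polypred_not: assumes "polypred P" shows "polypred (\<lambda>x. \<not> P x)"
proof -
  have "(\<lambda>x. if \<not> P x then Node Leaf Leaf else Leaf) = (\<lambda>x. if P x then Leaf else Node Leaf Leaf)"
    by auto
  then show ?thesis
    using polytime_if[OF assms polytime_const polytime_const, of Leaf "Node Leaf Leaf"]
    by (simp only: polypred_def)
qed

lemma polypred_conj:
  assumes "polypred P" "polypred Q" shows "polypred (\<lambda>x. P x \<and> Q x)"
proof -
  have "(\<lambda>x. if P x \<and> Q x then Node Leaf Leaf else Leaf) =
      (\<lambda>x. if P x then (if Q x then Node Leaf Leaf else Leaf) else Leaf)" by auto
  then show ?thesis unfolding polypred_def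
    using polytime_if[OF assms(1) polytime_if[OF assms(2) polytime_const polytime_const] polytime_const]
    by simp
qed

lemma polypred_disj:
  assumes "polypred P" "polypred Q" shows "polypred (\<lambda>x. P x \<or> Q x)"
  using polypred_not[OF polypred_conj[OF polypred_not[OF assms(1)] polypred_not[OF assms(2)]]] by simp

section \<open>Loops and iteration over lists\<close>

text \<open>\<open>I x n y\<close> says that on input \<open>x\<close> the loop can reach \<open>y\<close> with \<open>n\<close> iterations left; \<open>F\<close> is
  the final value of the loop, hence invariant under the body \<open>f\<close>.\<close>

lemma polytime_while:
  assumes "polytime b" "polytime f" "polytime g" "polybounded S" "polybounded N"
    and init: "\<And>x. \<exists>n\<le>N (tsize x). I x n (g x)"
    and more: "\<And>x n y. I x (Suc n) y \<Longrightarrow> b y \<noteq> Leaf \<and> I x n (f y) \<and> F (f y) = F y"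
    and stop: "\<And>x y. I x 0 y \<Longrightarrow> b y = Leaf \<and> F y = y"
    and size: "\<And>x n y. I x n y \<Longrightarrow> tsize y \<le> S (tsize x)"
  shows "polytime (\<lambda>x. F (g x))"
proof -
  from assms(1) obtain p B where p: "polybounded B" "\<And>x. \<exists>t. exec p x (b x) t \<and> t \<le> B (tsize x)"
    by (elim polytimeE) blast
  from assms(2) obtain q C where q: "polybounded C" "\<And>x. \<exists>t. exec q x (f x) t \<and> t \<le> C (tsize x)"
    by (elim polytimeE) blast
  from assms(3) obtain r D where r: "polybounded D" "\<And>x. \<exists>t. exec r x (g x) t \<and> t \<le> D (tsize x)"
    by (elim polytimeE) blast
  \<comment> \<open>Bound for one round: test, body and the charge for the current tree, whose size
    never exceeds \<open>S n\<close>.\<close>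
  define T where "T n = B (S n) + C (S n) + S n" for n
  show ?thesis
  proof (rule polytimeI[of "\<lambda>n. D n + (N n + 1) * T n + n" "SEQ r (WHILE p q)"])
    show "polybounded (\<lambda>n. D n + (N n + 1) * T n + n)"
      unfolding T_def using p(1) q(1) r(1) assms(4,5)
      by (intro polybounded_intros polybounded_comp[of B S] polybounded_comp[of C S])
    fix x
    \<comment> \<open>The factor is \<open>n + 1\<close> because the last, failing test is paid for
      as well.\<close>
    have run: "\<exists>t. exec (WHILE p q) y (F y) t \<and> t \<le> (n + 1) * T (tsize x)" if "I x n y" for n y
      using that
    proof (induction n arbitrary: y)
      case 0
      obtain s where s: "exec p y (b y) s" "s \<le> B (tsize y)" using p by blast
      have "s \<le> B (S (tsize x))" "tsize y \<le> S (tsize x)"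
        using polyboundedD[OF p(1) size[OF 0]] s(2) size[OF 0] by linarith+
      then show ?case using exec.while_false[of p y s q] s stop[OF 0]
        by (intro exI[of _ "s + tsize y"]) (auto simp: T_def)
    next
      case (Suc n)
      obtain s where s: "exec p y (b y) s" "s \<le> B (tsize y)" using p by blast
      obtain t where t: "exec q y (f y) t" "t \<le> C (tsize y)" using q by blast
      note y = more[OF Suc.prems]
      with Suc.IH obtain u where u: "exec (WHILE p q) (f y) (F y) u" "u \<le> (n + 1) * T (tsize x)"
        by metis
      have "s \<le> B (S (tsize x))" "t \<le> C (S (tsize x))" "tsize y \<le> S (tsize x)"
        using polyboundedD[OF p(1) size[OF Suc.prems]] polyboundedD[OF q(1) size[OF Suc.prems]]
          s(2) t(2) size[OF Suc.prems] by linarith+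
      then have "s + t + u + tsize y \<le> (Suc n + 1) * T (tsize x)"
        using u(2) by (simp add: T_def)
      then show ?case using exec.while_true[OF s(1) _ t(1) u(1)] y by blast
    qed
    obtain n where n: "n \<le> N (tsize x)" "I x n (g x)" using init by blast
    from run[OF n(2)] obtain t
      where t: "exec (WHILE p q) (g x) (F (g x)) t" "t \<le> (n + 1) * T (tsize x)" by blast
    obtain u where u: "exec r x (g x) u" "u \<le> D (tsize x)" using r by blast
    have "(n + 1) * T (tsize x) \<le> (N (tsize x) + 1) * T (tsize x)" using n(1) by simp
    then have "u + t + tsize x \<le> D (tsize x) + (N (tsize x) + 1) * T (tsize x) + tsize x"
      using t(2) u(2) by linarith
    then show "\<exists>t. exec (SEQ r (WHILE p q)) x (F (g x)) t \<and>
        t \<le> D (tsize x) + (N (tsize x) + 1) * T (tsize x) + tsize x"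
      using exec.seq[OF u(1) t(1)] by blast
  qed
qed

text \<open>Appending in reversed order is tail recursive and hence a single loop. The lists built
  with it stand for sets or numbers, so the order is irrelevant.\<close>

primrec rev_app :: "tree \<Rightarrow> tree \<Rightarrow> tree" where
  "rev_app Leaf acc = acc"
| "rev_app (Node h t) acc = rev_app t (Node h acc)"

lemma set_of_simps [simp]: "set_of Leaf = {}" "set_of (Node h t) = insert h (set_of t)"
  by (auto simp: set_of_def)

lemma nat_of_simps [simp]: "nat_of Leaf = 0" "nat_of (Node h t) = Suc (nat_of t)"
  by (auto simp: nat_of_def)

lemma set_of_rev_app [simp]: "set_of (rev_app l acc) = set_of l \<union> set_of acc"
  by (induction l arbitrary: acc) auto

lemma nat_of_rev_app [simp]: "nat_of (rev_app l acc) = nat_of l + nat_of acc"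
  by (induction l arbitrary: acc) auto

lemma tsize_rev_app: "tsize (rev_app l acc) + 1 = tsize l + tsize acc"
  by (induction l arbitrary: acc) auto

lemma nat_of_le_tsize: "nat_of l \<le> tsize l"
  by (induction l) auto

text \<open>The loop state is the rest of the list paired with the accumulator. A round moves one
  cell from the former to the latter, so the size of the state stays constant.\<close>

lemma polytime_rev_app:
  assumes "polytime f" "polytime g" shows "polytime (\<lambda>x. rev_app (f x) (g x))"
proof -
  let ?I = "\<lambda>x n y. tsize y \<le> tsize (Node (f x) (g x)) \<and> (\<exists>l acc. y = Node l acc \<and> nat_of l = n)"
  let ?step = "\<lambda>x. Node (right (left x)) (Node (left (left x)) (right x))"
  let ?F = "\<lambda>y. Node Leaf (rev_app (left y) (right y))"
  obtain B where B: "polybounded B" "\<And>x. tsize (Node (f x) (g x)) \<le> B (tsize x)"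
    using polytimeE[OF polytime_Node[OF assms]] by metis
  have "polytime (\<lambda>x. ?F (Node (f x) (g x)))"
  proof (rule polytime_while[where b = left and S = B and N = B and I = ?I and f = ?step and F = ?F])
    show "\<exists>n\<le>B (tsize x). ?I x n (Node (f x) (g x))" for x
      using B(2)[of x] nat_of_le_tsize[of "f x"] by (intro exI[of _ "nat_of (f x)"]) auto
    fix x n y
    show "?I x n y \<Longrightarrow> tsize y \<le> B (tsize x)" using B(2)[of x] by linarith
    assume "?I x (Suc n) y"
    then obtain l acc where y: "y = Node l acc" "nat_of l = Suc n" "tsize y \<le> tsize (Node (f x) (g x))"
      by blast
    then show "left y \<noteq> Leaf \<and> ?I x n (?step y) \<and> ?F (?step y) = ?F y"
      by (cases l) auto
  next
    fix x y
    assume "?I x 0 y"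
    then obtain l acc where y: "y = Node l acc" "nat_of l = 0" by blast
    then show "left y = Leaf \<and> ?F y = y" by (cases l) auto
  next
    show "polytime left" "polytime ?step" "polytime (\<lambda>x. Node (f x) (g x))"
      by (intro polytime_left polytime_right polytime_Node polytime_id assms)+
  qed (rule B)+
  from polytime_right[OF this] show ?thesis by simp
qed

text \<open>The nonempty suffixes of a list. Unlike entries they are distinct for distinct
  positions, and \<open>left\<close> recovers the entry at that position.\<close>

primrec tails :: "tree \<Rightarrow> tree set" where
  "tails Leaf = {}"
| "tails (Node h t) = insert (Node h t) (tails t)"

text \<open>A concatenating map over suffixes, with an accumulator to make it a loop. Programs have
  no variables, so whatever \<open>g\<close> needs besides the suffix is passed as the environment
  \<open>e\<close>.\<close>

primrec collect :: "(tree \<Rightarrow> tree \<Rightarrow> tree) \<Rightarrow> tree \<Rightarrow> tree \<Rightarrow> tree \<Rightarrow> tree" where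
  "collect g e Leaf acc = acc"
| "collect g e (Node h t) acc = collect g e t (rev_app (g e (Node h t)) acc)"

lemma set_of_collect: "set_of (collect g e l acc) = (\<Union>s\<in>tails l. set_of (g e s)) \<union> set_of acc"
  by (induction l arbitrary: acc) auto

lemma polytime_collect:
  assumes g: "polytime (\<lambda>y. g (left y) (right y))"
    and e: "polytime e" and l: "polytime l" and a: "polytime a"
  shows "polytime (\<lambda>x. collect g (e x) (l x) (a x))"
proof -
  let ?s = "\<lambda>x. Node (l x) (Node (e x) (a x))"
  let ?step = "\<lambda>y. Node (right (left y)) (Node (left (right y))
      (rev_app (g (left (right y)) (left y)) (right (right y))))"
  let ?F = "\<lambda>y. Node Leaf (Node (left (right y))
      (collect g (left (right y)) (left y) (right (right y))))"
  have s: "polytime ?s" by (intro polytime_Node e l a)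
  obtain B where B: "polybounded B" "\<And>x. tsize (?s x) \<le> B (tsize x)"
    using polytimeE[OF s] by metis
  obtain G where G: "polybounded G" "\<And>y. tsize (g (left y) (right y)) \<le> G (tsize y)"
    using polytimeE[OF g] by metis
  \<comment> \<open>The initial state, plus at most \<open>B n\<close> rounds that each add the
    output of one call of \<open>g\<close>.\<close>
  define S where "S n = B n + B n * G (B n)" for n
  \<comment> \<open>The current size plus a reserve for the remaining rounds does not increase. Each
    call of \<open>g\<close> sees the environment and a suffix, together no larger than the initial
    state.\<close>
  let ?I = "\<lambda>x n y. tsize y + n * G (B (tsize x)) \<le> S (tsize x) \<and>
      (\<exists>l' acc. y = Node l' (Node (e x) acc) \<and> nat_of l' = n \<and> tsize l' \<le> tsize (l x))"
  have "polytime (\<lambda>x. ?F (?s x))"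
  proof (rule polytime_while[where b = left and S = S and N = B and I = ?I and f = ?step and F = ?F])
    have "polytime (\<lambda>y. g (left (right y)) (left y))"
      using polytime_comp[OF g, of "\<lambda>y. Node (left (right y)) (left y)"]
      by (simp add: polytime_left polytime_right polytime_Node polytime_id)
    then show "polytime ?step"
      by (intro polytime_left polytime_right polytime_Node polytime_id polytime_rev_app)
    show "polybounded S" unfolding S_def using B(1) G(1)
      by (intro polybounded_intros polybounded_comp[of G B])
    show "\<exists>n\<le>B (tsize x). ?I x n (?s x)" for x
    proof (intro exI[of _ "nat_of (l x)"] conjI)
      show n: "nat_of (l x) \<le> B (tsize x)" using B(2)[of x] nat_of_le_tsize[of "l x"] by simp
      show "tsize (?s x) + nat_of (l x) * G (B (tsize x)) \<le> S (tsize x)"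
        unfolding S_def using B(2)[of x] n by (intro add_mono mult_le_mono1)
    qed auto
    fix x n y
    show "?I x n y \<Longrightarrow> tsize y \<le> S (tsize x)" by linarith
    assume "?I x (Suc n) y"
    then obtain h t acc where y: "y = Node (Node h t) (Node (e x) acc)" "nat_of t = n"
      "tsize (Node h t) \<le> tsize (l x)" and b: "tsize y + Suc n * G (B (tsize x)) \<le> S (tsize x)"
      by (metis nat_of_simps nat.distinct(1) nat.inject tree.exhaust)
    have "tsize (g (e x) (Node h t)) \<le> G (tsize (Node (e x) (Node h t)))"
      using G(2)[of "Node (e x) (Node h t)"] by simp
    also have "\<dots> \<le> G (B (tsize x))"
      using B(2)[of x] y(3) by (intro polyboundedD[OF G(1)]) auto
    finally show "left y \<noteq> Leaf \<and> ?I x n (?step y) \<and> ?F (?step y) = ?F y"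
      using y b tsize_rev_app[of "g (e x) (Node h t)" acc] by auto
  next
    fix x y
    assume "?I x 0 y"
    then obtain l' acc where y: "y = Node l' (Node (e x) acc)" "nat_of l' = 0" by blast
    then show "left y = Leaf \<and> ?F y = y" by (cases l') auto
  qed (use B s in \<open>auto intro: polytime_left polytime_id\<close>)
  from polytime_right[OF polytime_right[OF this]] show ?thesis by simp
qed

lemmas polytime_intros = polytime_const polytime_id polytime_left polytime_right polytime_Node
  polytime_if polytime_rev_app polytime_collect

lemma left_tails: "left ` tails l = set_of l"
  by (induction l) auto

text \<open>One entry is collected for each occurrence; membership means that the collected list is
  not \<open>Leaf\<close>.\<close>

lemma polypred_mem:
  assumes "polytime f" "polytime l" shows "polypred (\<lambda>x. f x \<in> set_of (l x))"
proof -
  let ?c = "\<lambda>x. collect (\<lambda>a s. if left s = a then Node Leaf Leaf else Leaf) (f x) (l x) Leaf"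
  have "f x \<in> set_of (l x) \<longleftrightarrow> ?c x \<noteq> Leaf" for x
  proof -
    have "?c x \<noteq> Leaf \<longleftrightarrow> set_of (?c x) \<noteq> {}" by (cases "?c x") auto
    also have "\<dots> \<longleftrightarrow> (\<exists>s\<in>tails (l x). left s = f x)"
      by (auto simp: set_of_collect split: if_splits)
    finally show ?thesis unfolding left_tails[symmetric] image_iff by metis
  qed
  moreover have "polytime ?c"
    by (intro polytime_intros polypred_eq assms)
  ultimately show ?thesis by (simp add: polypred_not polypred_eq polytime_const)
qed

lemmas polypred_intros = polypred_const polypred_not polypred_conj polypred_disj polypred_eq polypred_mem

text \<open>Two nested iterations. The outer environment \<open>Node e X\<close> keeps the list
  available for the inner one, whose environment \<open>Node (Node e X) a\<close> also holds the
  first component \<open>a\<close>.\<close>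

definition pairs :: "(tree \<Rightarrow> tree \<Rightarrow> tree \<Rightarrow> bool) \<Rightarrow> tree \<Rightarrow> tree \<Rightarrow> tree" where
  "pairs R e X = collect (\<lambda>e s. collect
      (\<lambda>e s. if R (left (left e)) (right e) (left s) then Node (Node (right e) (left s)) Leaf else Leaf)
      (Node e (left s)) (right e) Leaf) (Node e X) X Leaf"

lemma rel_of_pairs: "rel_of (pairs R e X) = {(a, b). a \<in> set_of X \<and> b \<in> set_of X \<and> R e a b}"
  by (fastforce simp: rel_of_def pairs_def set_of_collect left_tails[of X, symmetric] split: if_splits)

lemma polytime_pairs:
  assumes R: "polypred (\<lambda>y. R (left y) (left (right y)) (right (right y)))"
    and "polytime e" "polytime X"
  shows "polytime (\<lambda>x. pairs R (e x) (X x))"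
proof -
  have "polypred (\<lambda>y. R (left (left (left y))) (right (left y)) (left (right y)))"
    unfolding polypred_def
    using polytime_comp[OF R[unfolded polypred_def],
        of "\<lambda>y. Node (left (left (left y))) (Node (right (left y)) (left (right y)))"]
    by (simp add: polytime_intros)
  then show ?thesis unfolding pairs_def by (intro polytime_intros assms)
qed

section \<open>Stable and admissible extensions\<close>

lemma adm_iff:
  "S \<in> adm (X, A) \<longleftrightarrow> S \<subseteq> X \<and> (\<forall>x\<in>S. \<forall>y\<in>S. (x, y) \<notin> A) \<and>
    (\<forall>s\<in>S. \<forall>x\<in>X. (x, s) \<in> A \<longrightarrow> (\<exists>y\<in>S. (y, x) \<in> A))"
  by (auto simp: adm_def conflict_free_def defended_def)

lemma stb_iff:
  "S \<in> stb (X, A) \<longleftrightarrow> S \<subseteq> X \<and> (\<forall>x\<in>S. \<forall>y\<in>S. (x, y) \<notin> A) \<and> (\<forall>x\<in>X - S. \<exists>y\<in>S. (y, x) \<in> A)"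
  by (auto simp: stb_def conflict_free_def rng_def)

text \<open>With \<open>semantics_subset_adm\<close> this encloses every \<sigma> between
  \<open>stb\<close> and \<open>adm\<close>. It then suffices to show that certain sets are stable
  and that no other nonempty set is admissible.\<close>

lemma stb_subset_semantics:
  assumes "is_af F" "\<sigma> \<in> {adm, com, pref, sem, stb}"
  shows "stb F \<subseteq> \<sigma> F"
proof
  fix S
  assume S: "S \<in> stb F"
  obtain X A where F: "F = (X, A)" by force
  have A: "A \<subseteq> X \<times> X" using assms(1) by (auto simp: is_af_def F)
  have S': "S \<subseteq> X" "\<forall>x\<in>S. \<forall>y\<in>S. (x, y) \<notin> A" "\<forall>x\<in>X - S. \<exists>y\<in>S. (y, x) \<in> A"
    using S unfolding F stb_iff by auto
  have a: "S \<in> adm F" unfolding F adm_iff using S' by blast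
  \<comment> \<open>An argument outside \<open>S\<close> is attacked from \<open>S\<close>. If it
    were defended, \<open>S\<close> would attack one of its own members.\<close>
  have "S \<in> com F" unfolding com_def using a S' A by (auto simp: F defended_def) blast
  moreover have "S \<in> pref F" unfolding pref_def
  proof (intro CollectI conjI a notI)
    assume "\<exists>T\<in>adm F. S \<subset> T"
    then obtain T where "T \<in> adm F" "S \<subset> T" by blast
    then show False unfolding F adm_iff using S'(3) by blast
  qed
  \<comment> \<open>The range of \<open>S\<close> is already the set of all arguments.\<close>
  moreover have "S \<in> sem F"
    using a S unfolding sem_def stb_def by (auto simp: F rng_def)
  ultimately show "S \<in> \<sigma> F" using assms(2) a S by auto
qed

text \<open>Only stability needs an argument: by conflict-freeness an attacker of a member lies
  outside the set, so the set attacks it.\<close>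

lemma semantics_subset_adm:
  assumes "\<sigma> \<in> {adm, com, pref, sem, stb}"
  shows "\<sigma> F \<subseteq> adm F"
proof -
  have "stb F \<subseteq> adm F" by (cases F) (auto simp: stb_iff adm_iff subset_iff)
  then show ?thesis using assms by (auto simp: com_def pref_def sem_def)
qed

section \<open>The framework of a partite graph\<close>

definition tA :: tree where "tA = unary 0"
definition tB :: tree where "tB = unary 1"
definition tP :: tree where "tP = unary 2"
definition tQ :: tree where "tQ = unary 3"
definition tV :: tree where "tV = unary 4"
definition tW :: tree where "tW = unary 5"
definition tZ :: tree where "tZ = unary 6"

lemma nat_of_unary [simp]: "nat_of (unary n) = n"
  by (induction n) auto

lemma unary_eq_iff: "unary m = unary n \<longleftrightarrow> m = n"
  by (metis nat_of_unary)

lemmas tag_defs = tA_def tB_def tP_def tQ_def tV_def tW_def tZ_def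

lemma tags_distinct [simp]:
  "tA \<noteq> tB" "tA \<noteq> tP" "tA \<noteq> tQ" "tA \<noteq> tV" "tA \<noteq> tW" "tA \<noteq> tZ"
  "tB \<noteq> tA" "tB \<noteq> tP" "tB \<noteq> tQ" "tB \<noteq> tV" "tB \<noteq> tW" "tB \<noteq> tZ"
  "tP \<noteq> tA" "tP \<noteq> tB" "tP \<noteq> tQ" "tP \<noteq> tV" "tP \<noteq> tW" "tP \<noteq> tZ"
  "tQ \<noteq> tA" "tQ \<noteq> tB" "tQ \<noteq> tP" "tQ \<noteq> tV" "tQ \<noteq> tW" "tQ \<noteq> tZ"
  "tV \<noteq> tA" "tV \<noteq> tB" "tV \<noteq> tP" "tV \<noteq> tQ" "tV \<noteq> tW" "tV \<noteq> tZ"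
  "tW \<noteq> tA" "tW \<noteq> tB" "tW \<noteq> tP" "tW \<noteq> tQ" "tW \<noteq> tV" "tW \<noteq> tZ"
  "tZ \<noteq> tA" "tZ \<noteq> tB" "tZ \<noteq> tP" "tZ \<noteq> tQ" "tZ \<noteq> tV" "tZ \<noteq> tW"
  unfolding tag_defs unary_eq_iff by simp_all

text \<open>The environment \<open>e\<close> is \<open>Node (Node Leaf Vs) Es\<close>:
  \<open>left e\<close> is one of the two additional indices, \<open>right e\<close> lists the
  edges. An index \<open>s\<close> stands for the part \<open>left s\<close>. At both additional
  indices this is \<open>Leaf\<close>, the empty part, so no vertex attacks their w. Each edge is
  looked up in both orientations.\<close>

definition attack :: "tree \<Rightarrow> tree \<Rightarrow> tree \<Rightarrow> bool" where
  "attack e a b \<longleftrightarrow>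
     left a = tW \<or> left a = tQ \<or>
     left a = tP \<and> left b = tQ \<and> right a = right b \<or>
     left a = tA \<and> (left b = tW \<and> right a = right b \<or> left b = tB \<or> left b = tV \<or> left b = tZ) \<or>
     left a = tB \<and> (left b = tW \<and> right a = right b \<or> left b = tA \<or> left b = tV \<or> left b = tZ) \<or>
     left a = tZ \<and> (left b = tA \<or> left b = tB \<or> left b = tW \<and> (right b = Leaf \<or> right b = left e)) \<or>
     left a = tV \<and> (left b = tA \<or> left b = tB \<or> left b = tW \<and> right a \<in> set_of (left (right b)) \<or>
       left b = tV \<and> \<not> (right a = right b \<or> Node (right a) (right b) \<in> set_of (right e) \<or>
         Node (right b) (right a) \<in> set_of (right e)))"

text \<open>A part is represented by the tail of \<open>Vs\<close> that starts with it, since two empty parts may have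
  the same code. The list in use is \<open>Node Leaf Vs\<close>; this tree itself and \<open>Leaf\<close> are the two
  additional indices. They make the extensions without vertices larger than those given by a
  clique. Only \<open>z\<close> can replace \<open>a\<close> or \<open>b\<close> there, so \<open>k = 0\<close> is not a special case.\<close>

definition tagged :: "tree \<Rightarrow> tree \<Rightarrow> tree \<Rightarrow> tree" where
  "tagged T l acc = collect (\<lambda>T s. Node (Node T s) Leaf) T l (Node (Node T Leaf) acc)"

definition indices :: "tree \<Rightarrow> tree set" where
  "indices l = insert Leaf (tails l)"

lemma set_of_tagged: "set_of (tagged T l acc) = Node T ` indices l \<union> set_of acc"
  by (auto simp: tagged_def indices_def set_of_collect)

text \<open>As \<open>Node h t\<close> is larger than \<open>t\<close>, it is not a suffix of
  \<open>t\<close>. This makes the suffixes of a list pairwise distinct.\<close>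

lemma tsize_tails: "s \<in> tails l \<Longrightarrow> tsize s \<le> tsize l"
  by (induction l) auto

lemma finite_tails [simp]: "finite (tails l)"
  by (induction l) auto

lemma finite_indices [simp]: "finite (indices l)"
  by (simp add: indices_def)

lemma card_tails: "card (tails l) = nat_of l"
proof (induction l)
  case (Node h t)
  then show ?case using tsize_tails[of "Node h t" t] by (auto simp: card_insert_if)
qed simp

lemma Leaf_notin_tails [simp]: "Leaf \<notin> tails l"
  by (induction l) auto

lemma card_indices: "card (indices l) = nat_of l + 1"
  by (simp add: indices_def card_tails)

definition arguments :: "tree \<Rightarrow> tree" where
  "arguments Vs =
     tagged tA (Node Leaf Vs) (tagged tB (Node Leaf Vs) (tagged tP (Node Leaf Vs)
       (tagged tQ (Node Leaf Vs) (tagged tW (Node Leaf Vs)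
         (collect (\<lambda>T s. collect (\<lambda>T s. Node (Node T (left s)) Leaf) T (left s) Leaf) tV Vs
           (Node (Node tZ Leaf) Leaf))))))"

definition framework :: "tree \<Rightarrow> tree \<Rightarrow> tree" where
  "framework Vs Es = Node (arguments Vs) (pairs attack (Node (Node Leaf Vs) Es) (arguments Vs))"

lemma polypred_attack: "polypred (\<lambda>y. attack (left y) (left (right y)) (right (right y)))"
  unfolding attack_def by (intro polypred_intros polytime_intros)

lemma polytime_tagged:
  "polytime T \<Longrightarrow> polytime l \<Longrightarrow> polytime a \<Longrightarrow> polytime (\<lambda>x. tagged (T x) (l x) (a x))"
  unfolding tagged_def by (intro polytime_intros)

lemma polytime_framework:
  assumes "polytime V" "polytime E"
  shows "polytime (\<lambda>x. framework (V x) (E x))"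
  unfolding framework_def arguments_def
  by (intro polytime_intros polytime_tagged polytime_pairs polypred_attack assms)

lemma set_of_arguments:
  "set_of (arguments Vs) =
     Node tA ` indices (Node Leaf Vs) \<union> Node tB ` indices (Node Leaf Vs) \<union>
     Node tP ` indices (Node Leaf Vs) \<union> Node tQ ` indices (Node Leaf Vs) \<union>
     Node tW ` indices (Node Leaf Vs) \<union> Node tV ` (\<Union>V\<in>set_of Vs. set_of V) \<union> {Node tZ Leaf}"
proof -
  have "set_of (collect (\<lambda>T s. Node (Node T (left s)) Leaf) T l Leaf) = Node T ` set_of l" for T l
    unfolding set_of_collect left_tails[of l, symmetric] by auto
  then show ?thesis
    unfolding arguments_def set_of_tagged set_of_collect left_tails[of Vs, symmetric] by auto
qed

lemma is_af_framework: "is_af (af_of (framework Vs Es))"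
  by (auto simp: is_af_def af_of_def framework_def rel_of_pairs set_of_def)

text \<open>The sets a + p and b + p are given as codes because instances of Adjust and Center
  contain them and the reduction has to output them.\<close>

definition extension :: "tree \<Rightarrow> tree \<Rightarrow> tree" where
  "extension T Vs = tagged T (Node Leaf Vs) (tagged tP (Node Leaf Vs) Leaf)"

locale partite_graph =
  fixes k :: nat and Vs Es :: tree
  assumes k_partite: "k_partite k (map set_of (list_of Vs)) (edges_of Es)"
begin

abbreviation I where "I \<equiv> indices (Node Leaf Vs)"
abbreviation F where "F \<equiv> af_of (framework Vs Es)"
abbreviation part where "part i \<equiv> set_of (list_of Vs ! i)"
abbreviation att where "att \<equiv> attack (Node (Node Leaf Vs) Es)"

section \<open>Cliques and parts of the graph\<close>

definition clique :: "tree set \<Rightarrow> bool" where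
  "clique C \<longleftrightarrow> C \<subseteq> (\<Union>i<k. part i) \<and> (\<forall>u\<in>C. \<forall>v\<in>C. u \<noteq> v \<longrightarrow> {u, v} \<in> edges_of Es)"

definition clique_extension :: "tree set \<Rightarrow> tree set" where
  "clique_extension C = Node tV ` C \<union> {Node tZ Leaf} \<union> Node tP ` I"

lemma length_Vs: "length (list_of Vs) = k"
  using k_partite by (simp add: k_partite_def)

text \<open>\<open>Node Leaf Vs\<close> has \<open>k + 1\<close> nonempty suffixes, and
  \<open>Leaf\<close> is one more index.\<close>

lemma card_I: "card I = k + 2"
  using length_Vs by (simp add: card_indices nat_of_def)

lemma set_of_Vs: "set_of Vs = (\<lambda>i. list_of Vs ! i) ` {..<k}"
  unfolding set_of_def using length_Vs by (auto simp: set_conv_nth)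

text \<open>Links parts indexed by suffixes, as in the framework, to parts indexed by position, as
  in \<open>k_partite\<close>.\<close>

lemma ball_tails: "(\<forall>s\<in>tails Vs. P (left s)) \<longleftrightarrow> (\<forall>i<k. P (list_of Vs ! i))"
proof -
  have "(\<forall>s\<in>tails Vs. P (left s)) \<longleftrightarrow> (\<forall>V\<in>set_of Vs. P V)"
    unfolding left_tails[symmetric] by simp
  then show ?thesis unfolding set_of_Vs by auto
qed

lemma part_disjoint: "i < k \<Longrightarrow> j < k \<Longrightarrow> u \<in> part i \<Longrightarrow> u \<in> part j \<Longrightarrow> i = j"
  using k_partite length_Vs unfolding k_partite_def by (auto simp: disjoint_iff)

text \<open>An edge joins two different parts, and these are disjoint. The case \<open>u = v\<close>
  excludes loops.\<close>

lemma part_independent: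
  assumes "i < k" "u \<in> part i" "v \<in> part i" shows "{u, v} \<notin> edges_of Es"
proof
  assume "{u, v} \<in> edges_of Es"
  then obtain a b where ab: "a < k" "b < k" "a \<noteq> b"
    "\<exists>x\<in>part a. \<exists>y\<in>part b. {u, v} = {x, y}"
    using k_partite length_Vs unfolding k_partite_def by fastforce
  then show False using part_disjoint assms by (metis doubleton_eq_iff)
qed

lemma edges_of_iff: "{u, v} \<in> edges_of Es \<longleftrightarrow> Node u v \<in> set_of Es \<or> Node v u \<in> set_of Es"
  by (auto simp: edges_of_def rel_of_def doubleton_eq_iff)

lemma card_clique:
  assumes "clique C" shows "card C = (\<Sum>i<k. card (C \<inter> part i))" and "\<And>i. i < k \<Longrightarrow> card (C \<inter> part i) \<le> 1"
proof -
  have "C = (\<Union>i<k. C \<inter> part i)" using assms by (auto simp: clique_def)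
  then have "card C = card (\<Union>i<k. C \<inter> part i)" by simp
  also have "\<dots> = (\<Sum>i<k. card (C \<inter> part i))"
    by (rule card_UN_disjoint) (use part_disjoint in \<open>auto simp: set_of_def\<close>)
  finally show "card C = (\<Sum>i<k. card (C \<inter> part i))" .
  fix i assume i: "i < k"
  have "\<forall>u\<in>C \<inter> part i. \<forall>v\<in>C \<inter> part i. u = v"
    using assms part_independent[OF i] unfolding clique_def by blast
  moreover have "finite (C \<inter> part i)" by (simp add: set_of_def)
  ultimately show "card (C \<inter> part i) \<le> 1" by (simp add: card_le_Suc0_iff_eq)
qed

text \<open>The size is a sum of \<open>k\<close> terms, each at most 1, hence equal to
  \<open>k\<close> exactly if no term vanishes. For cliques, having size \<open>k\<close> thus means
  meeting every part, which the attacks on the w's can express.\<close>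

lemma card_clique_eq_iff:
  assumes "clique C" shows "card C = k \<longleftrightarrow> (\<forall>i<k. C \<inter> part i \<noteq> {})"
proof -
  note c = card_clique[OF assms]
  have fin: "finite (C \<inter> part i)" for i by (simp add: set_of_def)
  show ?thesis
  proof
    assume *: "card C = k"
    show "\<forall>i<k. C \<inter> part i \<noteq> {}"
    proof (intro allI impI notI)
      fix i assume i: "i < k" "C \<inter> part i = {}"
      have "(\<Sum>i<k. card (C \<inter> part i)) < (\<Sum>i<k. 1)"
        using i c(2) by (intro sum_strict_mono_ex1 bexI[of _ i]) auto
      then show False using c(1) * by simp
    qed
  next
    assume *: "\<forall>i<k. C \<inter> part i \<noteq> {}"
    have "card (C \<inter> part i) = 1" if "i < k" for i
      using * c(2)[OF that] that fin[of i] by (metis card_0_eq le_antisym less_one not_le)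
    then show "card C = k" using c(1) by simp
  qed
qed

lemma has_clique_iff:
  "has_clique k (map set_of (list_of Vs)) (edges_of Es) \<longleftrightarrow> (\<exists>C. clique C \<and> card C = k)"
proof -
  have "\<Union> (set (map set_of (list_of Vs))) = (\<Union>i<k. part i)"
    using set_of_Vs by (auto simp: set_of_def)
  then show ?thesis unfolding has_clique_def clique_def by metis
qed

section \<open>Arguments and attacks in the locale\<close>

lemma fst_F: "fst F = set_of (arguments Vs)"
  by (simp add: af_of_def framework_def)

lemma snd_F: "snd F = {(a, b). a \<in> fst F \<and> b \<in> fst F \<and> att a b}"
  by (simp add: af_of_def framework_def rel_of_pairs)

lemma fst_F_eq:
  "fst F = Node tA ` I \<union> Node tB ` I \<union> Node tP ` I \<union> Node tQ ` I \<union> Node tW ` I \<union>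
     Node tV ` (\<Union>i<k. part i) \<union> {Node tZ Leaf}"
  unfolding fst_F set_of_arguments set_of_Vs by simp

lemma Leaf_in_I: "Leaf \<in> I"
  by (simp add: indices_def)

lemma argument_iff:
  "Node T x \<in> fst F \<longleftrightarrow> T \<in> {tA, tB, tP, tQ, tW} \<and> x \<in> I \<or>
     T = tV \<and> x \<in> (\<Union>i<k. part i) \<or> T = tZ \<and> x = Leaf"
  unfolding fst_F_eq by auto

lemma Leaf_notin_arguments: "Leaf \<notin> fst F"
  unfolding fst_F_eq by auto

lemma ball_I: "(\<forall>s\<in>I. P s) \<longleftrightarrow> P Leaf \<and> P (Node Leaf Vs) \<and> (\<forall>s\<in>tails Vs. P s)"
  by (auto simp: indices_def)

lemma adm_F_iff:
  "S \<in> adm F \<longleftrightarrow> S \<subseteq> fst F \<and> (\<forall>x\<in>S. \<forall>y\<in>S. \<not> att x y) \<and>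
    (\<forall>s\<in>S. \<forall>x\<in>fst F. att x s \<longrightarrow> (\<exists>y\<in>S. att y x))"
  unfolding adm_iff[of S "fst F" "snd F", unfolded prod.collapse] snd_F by (auto simp: subset_iff)

lemma stb_F_iff:
  "S \<in> stb F \<longleftrightarrow> S \<subseteq> fst F \<and> (\<forall>x\<in>S. \<forall>y\<in>S. \<not> att x y) \<and> (\<forall>x\<in>fst F - S. \<exists>y\<in>S. att y x)"
  unfolding stb_iff[of S "fst F" "snd F", unfolded prod.collapse] snd_F by (auto simp: subset_iff)

section \<open>The extensions of the framework\<close>

lemma set_of_extension: "set_of (extension T Vs) = Node T ` I \<union> Node tP ` I"
  by (simp add: extension_def set_of_tagged)

lemma extension_stb:
  assumes "T = tA \<or> T = tB" shows "set_of (extension T Vs) \<in> stb F"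
  unfolding stb_F_iff set_of_extension
proof (intro conjI)
  show "Node T ` I \<union> Node tP ` I \<subseteq> fst F" using assms unfolding fst_F_eq by blast
  show "\<forall>x\<in>Node T ` I \<union> Node tP ` I. \<forall>y\<in>Node T ` I \<union> Node tP ` I. \<not> att x y"
    using assms by (auto simp: attack_def)
  let ?E = "Node T ` I \<union> Node tP ` I"
  have T: "Node T s \<in> ?E" and P: "Node tP s \<in> ?E" if "s \<in> I" for s using that by auto
  show "\<forall>x\<in>fst F - ?E. \<exists>y\<in>?E. att y x"
  proof
    fix x
    assume x: "x \<in> fst F - ?E"
    then obtain U s where Us: "x = Node U s" using Leaf_notin_arguments by (cases x) auto
    show "\<exists>y\<in>?E. att y x"
    proof (cases "U = tQ \<or> U = tW")
      case True
      then have s: "s \<in> I" using x unfolding Us by (auto simp: argument_iff)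
      \<comment> \<open>p attacks the q of its own index, and a or b the w of its own index.\<close>
      have "att (Node tP s) x \<or> att (Node T s) x" using True assms by (auto simp: Us attack_def)
      then show ?thesis using T[OF s] P[OF s] by blast
    next
      case False
      then have "U = tA \<or> U = tB \<or> U = tV \<or> U = tZ" "U \<noteq> T"
        using x assms unfolding Us by (auto simp: argument_iff)
      \<comment> \<open>Here the index of the attacker does not matter, so the index
        \<open>Leaf\<close>, which always exists, will do.\<close>
      then have "att (Node T Leaf) x" using assms by (auto simp: Us attack_def)
      then show ?thesis using T[OF Leaf_in_I] by blast
    qed
  qed
qed

lemma clique_extension_stb:
  assumes C: "clique C" "card C = k" shows "clique_extension C \<in> stb F"
  unfolding stb_F_iff
proof (intro conjI)
  let ?E = "clique_extension C"
  have hit: "\<forall>i<k. C \<inter> part i \<noteq> {}" using C card_clique_eq_iff by blast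
  have "Node tV u \<in> fst F" if "u \<in> C" for u
    using C(1) that unfolding clique_def argument_iff by blast
  moreover have "Node tZ Leaf \<in> fst F" "\<And>s. s \<in> I \<Longrightarrow> Node tP s \<in> fst F"
    unfolding argument_iff by simp_all
  ultimately show "?E \<subseteq> fst F" unfolding clique_extension_def by blast
  have "\<not> att (Node tV u) (Node tV v)" if "u \<in> C" "v \<in> C" for u v
    using C(1) that unfolding clique_def edges_of_iff attack_def by auto
  then show "\<forall>x\<in>?E. \<forall>y\<in>?E. \<not> att x y"
    unfolding clique_extension_def by (simp add: ball_Un) (simp add: attack_def)
  have z: "Node tZ Leaf \<in> ?E" by (simp add: clique_extension_def)
  \<comment> \<open>A vertex outside \<open>C\<close> is attacked by the vertex of \<open>C\<close>
    in its own part, since a part contains no edge.\<close>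
  have V: "\<exists>y\<in>?E. att y (Node tV u)" if u: "i < k" "u \<in> part i" "u \<notin> C" for i u
  proof -
    obtain v where v: "v \<in> C" "v \<in> part i" using hit u by blast
    then have "att (Node tV v) (Node tV u)"
      using part_independent[OF u(1) v(2) u(2)] u by (auto simp: attack_def edges_of_iff)
    then show ?thesis using v by (auto simp: clique_extension_def)
  qed
  have "\<forall>s\<in>tails Vs. C \<inter> set_of (left s) \<noteq> {}"
    using hit ball_tails[of "\<lambda>V. C \<inter> set_of V \<noteq> {}"] by simp
  \<comment> \<open>The w of a part is attacked by the clique vertex in that part; the two
    additional indices are left to z.\<close>
  then have "\<forall>s\<in>tails Vs. \<exists>v\<in>C. att (Node tV v) (Node tW s)" by (auto simp: attack_def)
  then have "\<forall>s\<in>tails Vs. \<exists>y\<in>?E. att y (Node tW s)" by (auto simp: clique_extension_def)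
  moreover have "att (Node tZ Leaf) (Node tW Leaf)" "att (Node tZ Leaf) (Node tW (Node Leaf Vs))"
    by (auto simp: attack_def)
  ultimately have W: "\<forall>s\<in>I. \<exists>y\<in>?E. att y (Node tW s)" unfolding ball_I using z by blast
  have Q: "\<forall>s\<in>I. \<exists>y\<in>?E. att y (Node tQ s)"
  proof
    fix s assume "s \<in> I"
    then show "\<exists>y\<in>?E. att y (Node tQ s)"
      by (intro bexI[of _ "Node tP s"]) (simp_all add: clique_extension_def attack_def)
  qed
  have AB: "\<exists>y\<in>?E. att y (Node tA s)" "\<exists>y\<in>?E. att y (Node tB s)" for s
    by (rule bexI[OF _ z], simp add: attack_def)+
  show "\<forall>x\<in>fst F - ?E. \<exists>y\<in>?E. att y x"
  proof
    fix x
    assume x: "x \<in> fst F - ?E"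
    then obtain T p where "x = Node T p" using Leaf_notin_arguments by (cases x) auto
    with x consider s where "s \<in> I" "x = Node tA s \<or> x = Node tB s \<or> x = Node tQ s \<or> x = Node tW s"
      | i u where "i < k" "u \<in> part i" "u \<notin> C" "x = Node tV u"
      unfolding clique_extension_def by (auto simp: argument_iff)
    then show "\<exists>y\<in>?E. att y x" using AB Q W V by cases metis+
  qed
qed

text \<open>The attacker of w at index \<open>Leaf\<close> decides the case, as it can only be an a,
  a b or z. Mutual attacks then exclude the other kinds, and the remaining w's force one argument
  per index, or a vertex in each part.\<close>

lemma adm_cases:
  assumes E: "E \<in> adm F" "E \<noteq> {}"
  shows "E = set_of (extension tA Vs) \<or> E = set_of (extension tB Vs) \<or>
    (\<exists>C. clique C \<and> card C = k \<and> E = clique_extension C)"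
proof -
  have sub: "E \<subseteq> fst F" and cf: "\<And>x y. x \<in> E \<Longrightarrow> y \<in> E \<Longrightarrow> \<not> att x y"
    and def: "\<And>s x. s \<in> E \<Longrightarrow> x \<in> fst F \<Longrightarrow> att x s \<Longrightarrow> \<exists>y\<in>E. att y x"
    using E(1) unfolding adm_F_iff by blast+
  have WQ: "left x \<noteq> tW \<and> left x \<noteq> tQ" if "x \<in> E" for x
    using cf[OF that that] by (auto simp: attack_def)
  obtain e where e: "e \<in> E" using E(2) by blast
  \<comment> \<open>Every q and w attacks \<open>e\<close>, so defending this one member already
    requires an attack on each of them.\<close>
  have hit: "\<exists>y\<in>E. att y (Node T s)" if "s \<in> I" "T = tW \<or> T = tQ" for s T
    using that by (intro def[OF e]) (auto simp: attack_def argument_iff)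
  have node: "x = Node (left x) (right x)" if "x \<in> E" for x
    using sub that Leaf_notin_arguments by (cases x) auto
  have arg: "Node (left x) (right x) \<in> fst F" if "x \<in> E" for x
    using node[OF that] sub that by auto
  have tag: "left x \<in> {tA, tB, tP, tV, tZ}" if "x \<in> E" for x
    using arg[OF that] WQ[OF that] unfolding argument_iff by auto
  have ind: "right x \<in> I" if "x \<in> E" "left x \<in> {tA, tB, tP}" for x
    using arg[OF that(1)] that(2) unfolding argument_iff by auto
  have vert: "right x \<in> (\<Union>i<k. part i)" if "x \<in> E" "left x = tV" for x
    using arg[OF that(1)] that(2) unfolding argument_iff by auto
  have leaf: "right x = Leaf" if "x \<in> E" "left x = tZ" for x
    using arg[OF that(1)] that(2) unfolding argument_iff by auto
  have P: "Node tP s \<in> E" if s: "s \<in> I" for s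
  proof -
    obtain y where y: "y \<in> E" "att y (Node tQ s)" using hit[OF s] by blast
    then have "left y = tP" "right y = s" using WQ[OF y(1)] by (auto simp: attack_def)
    then show ?thesis using node[OF y(1)] y(1) by metis
  qed
  obtain y where y: "y \<in> E" "att y (Node tW Leaf)" using hit Leaf_in_I by blast
  \<comment> \<open>No vertex qualifies: \<open>left Leaf\<close> is \<open>Leaf\<close>, which has
    no elements.\<close>
  then consider (AB) "left y = tA \<or> left y = tB" | (Z) "left y = tZ"
    using WQ[OF y(1)] by (auto simp: attack_def)
  then show ?thesis
  proof cases
    case AB
    define T where "T = left y"
    have T: "left x = T \<or> left x = tP" if "x \<in> E" for x
      using cf[OF y(1) that] tag[OF that] AB by (auto simp: attack_def T_def)
    have "Node T s \<in> E" if s: "s \<in> I" for s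
    proof -
      obtain x where x: "x \<in> E" "att x (Node tW s)" using hit[OF s] by blast
      then have "left x = T" "right x = s" using T[OF x(1)] AB by (auto simp: attack_def T_def)
      then show ?thesis using node[OF x(1)] x(1) by metis
    qed
    then have "Node T ` I \<union> Node tP ` I \<subseteq> E" using P by blast
    moreover have "E \<subseteq> Node T ` I \<union> Node tP ` I"
    proof
      fix x assume x: "x \<in> E"
      have "right x \<in> I" using T[OF x] AB ind[OF x] unfolding T_def by auto
      then show "x \<in> Node T ` I \<union> Node tP ` I" using node[OF x] T[OF x] by (metis UnI1 UnI2 imageI)
    qed
    ultimately have "E = Node T ` I \<union> Node tP ` I" by blast
    then show ?thesis using AB unfolding T_def set_of_extension by auto
  next
    case Z
    have T: "left x \<in> {tP, tV, tZ}" if "x \<in> E" for x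
      using cf[OF y(1) that] tag[OF that] Z by (auto simp: attack_def)
    define C where "C = {u. Node tV u \<in> E}"
    have "{u, v} \<in> edges_of Es" if "u \<in> C" "v \<in> C" "u \<noteq> v" for u v
      using that cf[of "Node tV u" "Node tV v"] unfolding C_def edges_of_iff
      by (auto simp: attack_def)
    moreover have "C \<subseteq> (\<Union>i<k. part i)"
      using vert[of "Node tV u" for u] unfolding C_def by auto
    ultimately have C: "clique C" unfolding clique_def by blast
    have "C \<inter> set_of (left s) \<noteq> {}" if s: "s \<in> tails Vs" for s
    proof -
      \<comment> \<open>A suffix of \<open>Vs\<close> is nonempty and smaller than
        \<open>Node Leaf Vs\<close>, so it is neither additional index. Hence z does not attack w at
        \<open>s\<close>, and a vertex has to.\<close>
      have "s \<in> I" "s \<noteq> Leaf" "s \<noteq> Node Leaf Vs"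
        using s tsize_tails[OF s] Leaf_notin_tails by (auto simp: indices_def)
      then obtain x where x: "x \<in> E" "att x (Node tW s)" using hit by blast
      then have "left x = tV" "right x \<in> set_of (left s)"
        using T[OF x(1)] \<open>s \<noteq> Leaf\<close> \<open>s \<noteq> Node Leaf Vs\<close> by (auto simp: attack_def)
      moreover have "Node tV (right x) \<in> E" using node[OF x(1)] x(1) calculation by metis
      ultimately show ?thesis unfolding C_def by blast
    qed
    then have "card C = k"
      using ball_tails[of "\<lambda>V. C \<inter> set_of V \<noteq> {}"] card_clique_eq_iff[OF C] by simp
    moreover have "E = clique_extension C"
    proof
      show "E \<subseteq> clique_extension C"
      proof
        fix x assume x: "x \<in> E"
        obtain U p where Up: "x = Node U p" using node[OF x] by blast
        show "x \<in> clique_extension C"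
          using T[OF x] ind[OF x] leaf[OF x] x unfolding clique_extension_def C_def Up by auto
      qed
      have "Node tZ Leaf \<in> E" using y(1) Z node[OF y(1)] leaf[OF y(1)] by metis
      then show "clique_extension C \<subseteq> E"
        using P unfolding clique_extension_def C_def by auto
    qed
    ultimately show ?thesis using C by blast
  qed
qed

section \<open>Sizes and distances\<close>

lemma card_image_Node: "card (Node T ` A) = card A"
  by (rule card_image) (auto simp: inj_on_def)

lemma finite_clique: "clique C \<Longrightarrow> finite C"
  by (rule finite_subset[of _ "\<Union>i<k. part i"]) (auto simp: clique_def set_of_def)

lemma card_extension:
  assumes "T = tA \<or> T = tB" shows "card (set_of (extension T Vs)) = 2 * k + 4"
proof -
  have "card (set_of (extension T Vs)) = card (Node T ` I) + card (Node tP ` I)"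
    unfolding set_of_extension
    using assms by (intro card_Un_disjoint) auto
  then show ?thesis by (simp add: card_image_Node card_I)
qed

text \<open>This is one less than the \<open>k + 2\<close> arguments of kind a or b. All four
  reductions rest on this gap or on the presence of z.\<close>

lemma card_clique_part:
  assumes "clique C" "card C = k" shows "card (Node tV ` C \<union> {Node tZ Leaf}) = k + 1"
proof -
  have "card (Node tV ` C \<union> {Node tZ Leaf}) = card (Node tV ` C) + card {Node tZ Leaf}"
    using finite_clique[OF assms(1)] by (intro card_Un_disjoint) auto
  then show ?thesis using assms(2) by (simp add: card_image_Node)
qed

lemma card_clique_extension:
  assumes "clique C" "card C = k" shows "card (clique_extension C) = 2 * k + 3"
proof -
  have "card (clique_extension C) = card (Node tV ` C \<union> {Node tZ Leaf}) + card (Node tP ` I)"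
    unfolding clique_extension_def
    using finite_clique[OF assms(1)] by (intro card_Un_disjoint) auto
  then show ?thesis using card_clique_part[OF assms] by (simp add: card_image_Node card_I)
qed

text \<open>The p's are common to both sets and cancel; \<open>k + 1\<close> and
  \<open>k + 2\<close> arguments remain.\<close>

lemma distance_clique_extension:
  assumes "clique C" "card C = k" "T = tA \<or> T = tB"
  shows "distance (clique_extension C) (set_of (extension T Vs)) = 2 * k + 3"
proof -
  have "sym_diff (clique_extension C) (set_of (extension T Vs)) =
      (Node tV ` C \<union> {Node tZ Leaf}) \<union> Node T ` I"
    using assms(3) unfolding clique_extension_def set_of_extension by auto
  moreover have "card \<dots> = card (Node tV ` C \<union> {Node tZ Leaf}) + card (Node T ` I)"
    using finite_clique[OF assms(1)] assms(3) by (intro card_Un_disjoint) auto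
  ultimately show ?thesis
    using card_clique_part[OF assms(1,2)] by (simp add: distance_def card_image_Node card_I)
qed

lemma distance_extensions:
  "distance (set_of (extension tA Vs)) (set_of (extension tB Vs)) = 2 * k + 4"
proof -
  have "sym_diff (set_of (extension tA Vs)) (set_of (extension tB Vs)) = Node tA ` I \<union> Node tB ` I"
    unfolding set_of_extension by auto
  moreover have "card \<dots> = card (Node tA ` I) + card (Node tB ` I)"
    by (intro card_Un_disjoint) auto
  ultimately show ?thesis by (simp add: distance_def card_image_Node card_I)
qed

section \<open>Correctness of the four reductions\<close>

context
  fixes \<sigma> :: "tree semantics"
  assumes \<sigma>: "\<sigma> \<in> {adm, com, pref, sem, stb}"
begin

lemma extension_mem: "T = tA \<or> T = tB \<Longrightarrow> set_of (extension T Vs) \<in> \<sigma> F"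
  using extension_stb stb_subset_semantics[OF is_af_framework \<sigma>] by blast

lemma clique_extension_mem: "clique C \<Longrightarrow> card C = k \<Longrightarrow> clique_extension C \<in> \<sigma> F"
  using clique_extension_stb stb_subset_semantics[OF is_af_framework \<sigma>] by blast

text \<open>The empty set stays as a case because some of the semantics admit it; each problem has
  to exclude it in its own way.\<close>

lemma semantics_cases:
  assumes "E \<in> \<sigma> F"
  obtains "E = {}" | "E = set_of (extension tA Vs)" | "E = set_of (extension tB Vs)"
    | C where "clique C" "card C = k" "E = clique_extension C"
  using adm_cases semantics_subset_adm[OF \<sigma>] assms by blast

lemma small_iff: "small \<sigma> F (2 * k + 3) \<longleftrightarrow> (\<exists>C. clique C \<and> card C = k)"
proof
  assume "small \<sigma> F (2 * k + 3)"
  then obtain E where "E \<in> \<sigma> F" "E \<noteq> {}" "card E \<le> 2 * k + 3" unfolding small_def by blast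
  then show "\<exists>C. clique C \<and> card C = k"
    by (cases rule: semantics_cases) (auto simp: card_extension)
next
  assume "\<exists>C. clique C \<and> card C = k"
  then obtain C where C: "clique C" "card C = k" by blast
  have "clique_extension C \<noteq> {}" by (simp add: clique_extension_def)
  then show "small \<sigma> F (2 * k + 3)"
    unfolding small_def using clique_extension_mem[OF C] card_clique_extension[OF C] by auto
qed

text \<open>The distance from the empty set is the cardinality, so Small is a special case of
  Repair.\<close>

lemma repair_iff: "repair \<sigma> F {} (2 * k + 3) \<longleftrightarrow> (\<exists>C. clique C \<and> card C = k)"
  unfolding small_iff[symmetric] by (simp add: repair_def small_def distance_def)

text \<open>z is not in the given extension, so it has to be added, and only clique extensions
  contain it.\<close>

lemma adjust_iff:
  "adjust \<sigma> F (set_of (extension tA Vs)) (Node tZ Leaf) (2 * k + 3) \<longleftrightarrow> (\<exists>C. clique C \<and> card C = k)"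
proof
  assume "adjust \<sigma> F (set_of (extension tA Vs)) (Node tZ Leaf) (2 * k + 3)"
  then obtain E where "E \<in> \<sigma> F" "Node tZ Leaf \<in> sym_diff (set_of (extension tA Vs)) E"
    unfolding adjust_def by blast
  then show "\<exists>C. clique C \<and> card C = k"
    by (cases rule: semantics_cases) (auto simp: set_of_extension)
next
  assume "\<exists>C. clique C \<and> card C = k"
  then obtain C where C: "clique C" "card C = k" by blast
  have "Node tZ Leaf \<in> sym_diff (set_of (extension tA Vs)) (clique_extension C)"
    by (auto simp: clique_extension_def set_of_extension)
  then show "adjust \<sigma> F (set_of (extension tA Vs)) (Node tZ Leaf) (2 * k + 3)"
    unfolding adjust_def using clique_extension_mem[OF C] distance_clique_extension[OF C, of tA]
    by (intro bexI[of _ "clique_extension C"]) auto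
qed

lemma center_iff:
  "center \<sigma> F (set_of (extension tA Vs)) (set_of (extension tB Vs)) \<longleftrightarrow> (\<exists>C. clique C \<and> card C = k)"
proof
  assume "center \<sigma> F (set_of (extension tA Vs)) (set_of (extension tB Vs))"
  then obtain E where E: "E \<in> \<sigma> F" "distance E (set_of (extension tA Vs)) < 2 * k + 4"
    "distance E (set_of (extension tB Vs)) < 2 * k + 4"
    unfolding center_def distance_extensions by blast
  from E(1) show "\<exists>C. clique C \<and> card C = k"
  proof (cases rule: semantics_cases)
    \<comment> \<open>The empty set is as far from a + p as b + p is: the distance is
      \<open>2 * k + 4\<close>, and a strict inequality is required.\<close>
    case 1
    then show ?thesis using E(2) card_extension[of tA] by (simp add: distance_def)
  next
    case 2
    then show ?thesis using E(3) distance_extensions by simp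
  next
    case 3
    then show ?thesis using E(2) distance_extensions by (simp add: distance_def Un_commute)
  qed blast
next
  assume "\<exists>C. clique C \<and> card C = k"
  then obtain C where C: "clique C" "card C = k" by blast
  show "center \<sigma> F (set_of (extension tA Vs)) (set_of (extension tB Vs))"
    unfolding center_def distance_extensions
    using clique_extension_mem[OF C] distance_clique_extension[OF C, of tA] distance_clique_extension[OF C, of tB]
    by (intro bexI[of _ "clique_extension C"]) auto
qed

end

end

section \<open>The reductions\<close>

text \<open>Numbers are lengths of lists, so addition is concatenation.\<close>

definition budget :: "tree \<Rightarrow> tree" where
  "budget k = rev_app k (rev_app k (unary 3))"

lemma nat_of_budget: "nat_of (budget k) = 2 * nat_of k + 3"
  by (simp add: budget_def)

lemma polytime_budget: "polytime f \<Longrightarrow> polytime (\<lambda>x. budget (f x))"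
  unfolding budget_def by (intro polytime_intros)

lemma polytime_extension: "polytime f \<Longrightarrow> polytime (\<lambda>x. extension T (f x))"
  unfolding extension_def by (intro polytime_intros polytime_tagged)

lemma computable_linear: "computable (\<lambda>k. 2 * k + c)"
  by (intro computable_add computable_mul computable_const computable_id)

text \<open>For a polynomial-time reduction the factor depending on the parameter is a constant
  function.\<close>

lemma fpt_reducibleI:
  assumes "polytime r" "computable g"
    and "\<And>x. x \<in> instances P \<Longrightarrow>
      r x \<in> instances Q \<and> (yes Q (r x) \<longleftrightarrow> yes P x) \<and> parameter Q (r x) \<le> g (parameter P x)"
  shows "P \<le>\<^sub>f\<^sub>p\<^sub>t Q"
proof -
  obtain p B where B: "polybounded B" "\<And>x. \<exists>t. exec p x (r x) t \<and> t \<le> B (tsize x)"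
    using polytimeE[OF assms(1)] by metis
  then obtain c where c: "\<And>n. n \<ge> 1 \<Longrightarrow> B n \<le> c * n ^ c" unfolding polybounded_def by blast
  have "\<exists>t. exec p x (r x) t \<and> t \<le> c * tsize x ^ c" for x
    using B(2)[of x] c[OF tsize_pos[of x]] le_trans by blast
  then show ?thesis unfolding fpt_reducible_def
    using assms(2,3) computable_const[of c]
    by (intro exI[of _ p] exI[of _ r] exI[of _ "\<lambda>k. c"] exI[of _ g] exI[of _ c]) auto
qed

text \<open>The bound \<open>2 * nat_of k + 4\<close> is the distance of the two given extensions in
  Center and also covers the budget \<open>2 * nat_of k + 3\<close> of the other three
  problems.\<close>

lemma W1_hardI:
  assumes "polytime r"
    and "\<And>k Vs Es. partite_graph (nat_of k) Vs Es \<Longrightarrow>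
      r (Node k (Node Vs Es)) \<in> instances Q \<and>
      (yes Q (r (Node k (Node Vs Es))) \<longleftrightarrow> (\<exists>C. partite_graph.clique (nat_of k) Vs Es C \<and> card C = nat_of k)) \<and>
      parameter Q (r (Node k (Node Vs Es))) \<le> 2 * nat_of k + 4"
  shows "W1_hard Q"
  unfolding W1_hard_iff
proof (rule fpt_reducibleI[OF assms(1) computable_linear[of 4]])
  fix x
  assume "x \<in> instances multicolored_clique"
  then obtain k Vs Es where x: "x = Node k (Node Vs Es)" and g: "partite_graph (nat_of k) Vs Es"
    unfolding multicolored_clique_def partite_graph_def by auto
  have "yes multicolored_clique x \<longleftrightarrow> (\<exists>C. partite_graph.clique (nat_of k) Vs Es C \<and> card C = nat_of k)"
    unfolding partite_graph.has_clique_iff[OF g, symmetric] by (simp add: multicolored_clique_def x)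
  moreover have "parameter multicolored_clique x = nat_of k"
    by (simp add: multicolored_clique_def x)
  ultimately show "r x \<in> instances Q \<and> (yes Q (r x) \<longleftrightarrow> yes multicolored_clique x) \<and>
      parameter Q (r x) \<le> 2 * parameter multicolored_clique x + 4"
    using assms(2)[OF g] unfolding x by simp
qed

theorem theorem1:
  fixes \<sigma> :: "tree af \<Rightarrow> tree set set"
  assumes "\<sigma> \<in> {adm, com, pref, sem, stb}"
  shows "W1_hard (small_problem \<sigma>) \<and> W1_hard (repair_problem \<sigma>) \<and>
         W1_hard (adjust_problem \<sigma>) \<and> W1_hard (center_problem \<sigma>)"
proof (intro conjI)
  let ?K = "\<lambda>d. budget (left d)"
  let ?F = "\<lambda>d. framework (left (right d)) (right (right d))"
  let ?E = "\<lambda>T d. extension T (left (right d))"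
  note poly = polytime_Node polytime_budget polytime_framework polytime_extension
    polytime_left polytime_right polytime_id polytime_const
  show "W1_hard (small_problem \<sigma>)"
    by (rule W1_hardI[of "\<lambda>d. Node (?F d) (?K d)"], intro poly)
      (simp add: small_problem_def is_af_framework nat_of_budget partite_graph.small_iff[OF _ assms])
  show "W1_hard (repair_problem \<sigma>)"
    by (rule W1_hardI[of "\<lambda>d. Node (?F d) (Node Leaf (?K d))"], intro poly)
      (simp add: repair_problem_def is_af_framework nat_of_budget partite_graph.repair_iff[OF _ assms])
  show "W1_hard (adjust_problem \<sigma>)"
    by (rule W1_hardI[of
          "\<lambda>d. Node (?F d) (Node (?E tA d) (Node (Node tZ Leaf) (?K d)))"], intro poly)
      (simp add: adjust_problem_def is_af_framework nat_of_budget partite_graph.adjust_iff[OF _ assms]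
        partite_graph.extension_mem[OF _ assms] partite_graph.argument_iff)
  show "W1_hard (center_problem \<sigma>)"
    by (rule W1_hardI[of "\<lambda>d. Node (?F d) (Node (?E tA d) (?E tB d))"], intro poly)
      (simp add: center_problem_def is_af_framework partite_graph.center_iff[OF _ assms]
        partite_graph.extension_mem[OF _ assms] partite_graph.distance_extensions)
qed

end
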